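(* Let $n\ge 2$, let $n_0$ be the product of the distinct prime divisors of $n$, let $k$ be the number of distinct prime divisors of $n$, and let $1=d_1<d_2<\dots<d_{2^k}=n_0$ be the divisors of $n_0$. Let $\Delta(Q_n)$ be the generating graph of the dicyclic group $Q_n$ after removing the isolated vertices. Then the distance spectrum of $\Delta(Q_n)$ is $$\begin{pmatrix}-2&-2-2\mu(d_2)\frac{\varphi(n)}{\varphi(d_2)}&-2-2\mu(d_3)\frac{\varphi(n)}{\varphi(d_3)}&\dots&-2-2\mu(d_{2^k})\frac{\varphi(n)}{\varphi(d_{2^k})}&\lambda_1&\lambda_2\\2(\varphi(n)+n)-n_0-1&\varphi(d_2)&\varphi(d_3)&\dots&\varphi(d_{2^k})&1&1\end{pmatrix},$$ where $$\lambda_1,\lambda_2=\left(\varphi(n)+2(n-1)\right)\pm\sqrt{\left(3\varphi(n)-2n\right)^2+4n\varphi(n)}.$$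
   Context: For $n\ge 2$, the dicyclic group is $Q_n=\langle x,y : x^{2n}=1,\ x^n=y^2,\ yx=x^{-1}y\rangle$, of order $4n$. The generating graph $\Gamma(G)$ of a group $G$ is the simple undirected graph with vertex set $G$ in which two distinct vertices $g,h$ are adjacent iff $\langle g,h\rangle=G$. The distance spectrum of a connected graph is the spectrum of its distance matrix, whose $(u,v)$ entry is the length $d(u,v)$ of a shortest path from $u$ to $v$. $\varphi$ is Euler's totient function and $\mu$ the Möbius function. In the two-row notation for a spectrum, the top row lists eigenvalues and the bottom row their multiplicities; the spectrum is a multiset (if the same number appears in several columns, the multiplicities add, and columns with multiplicity $0$ are void). *)

theory Defs
  imports
    "HOL-Algebra.Generated_Groups"
    "HOL-Number_Theory.Totient"
    "HOL-Computational_Algebra.Squarefree"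
    "Graph_Theory.Digraph_Component"
    "Jordan_Normal_Form.Char_Poly"
begin

text \<open>
  A word over the generators \<open>'g\<close> is a list of letters; \<open>(g, True)\<close> stands for the generator \<open>g\<close>
  and \<open>(g, False)\<close> for its formal inverse.
\<close>

type_synonym 'g word = "('g \<times> bool) list"

inductive pres_eq :: "('g word \<times> 'g word) set \<Rightarrow> 'g word \<Rightarrow> 'g word \<Rightarrow> bool"
  for R :: "('g word \<times> 'g word) set" where
  pres_rel: "(u, v) \<in> R \<Longrightarrow> pres_eq R u v"
| pres_cancel: "pres_eq R [(g, b), (g, \<not> b)] []"
| pres_refl: "pres_eq R u u"
| pres_sym: "pres_eq R u v \<Longrightarrow> pres_eq R v u"
| pres_trans: "pres_eq R u v \<Longrightarrow> pres_eq R v w \<Longrightarrow> pres_eq R u w"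
| pres_append: "pres_eq R u u' \<Longrightarrow> pres_eq R v v' \<Longrightarrow> pres_eq R (u @ v) (u' @ v')"

text \<open>
  The group \<open>\<langle>'g : u = v for (u, v) \<in> R\<rangle>\<close>: words modulo the least congruence that contains \<open>R\<close> and
  makes each letter cancel against its formal inverse.
\<close>

definition presented_group :: "('g word \<times> 'g word) set \<Rightarrow> 'g word set monoid" where
  "presented_group R =
    \<lparr> carrier = UNIV // {(u, v). pres_eq R u v},
      monoid.mult = (\<lambda>A B. {w. \<exists>u\<in>A. \<exists>v\<in>B. pres_eq R (u @ v) w}),
      monoid.one = {w. pres_eq R [] w} \<rparr>"

lemma presented_group_mult_class:
  "{w. pres_eq R u w} \<otimes>\<^bsub>presented_group R\<^esub> {w. pres_eq R v w} = {w. pres_eq R (u @ v) w}"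
proof -
  have "pres_eq R (u @ v) w" if "pres_eq R u u'" "pres_eq R v v'" "pres_eq R (u' @ v') w" for u' v' w
    using that pres_append pres_trans by metis
  then show ?thesis
    by (auto simp: presented_group_def intro: pres_refl)
qed

lemma carrier_presented_group:
  "carrier (presented_group R) = range (\<lambda>u. {w. pres_eq R u w})"
  by (auto simp: presented_group_def quotient_def)

lemma presented_group_word_inverse:
  "pres_eq R (rev (map (\<lambda>(g, b). (g, \<not> b)) u) @ u) []"
proof (induction u)
  case Nil
  show ?case by (simp add: pres_refl)
next
  case (Cons a u)
  obtain g b where a: "a = (g, b)" by (cases a)
  let ?v = "rev (map (\<lambda>(g, b). (g, \<not> b)) u)"
  have "pres_eq R [(g, \<not> b), (g, b)] []"
    using pres_cancel[of R g "\<not> b"] by simp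
  then have "pres_eq R (?v @ ([(g, \<not> b), (g, b)] @ u)) (?v @ ([] @ u))"
    by (intro pres_append pres_refl)
  then show ?case
    using Cons.IH a by (auto intro: pres_trans)
qed

lemma group_presented_group: "group (presented_group R)"
proof (rule groupI)
  have one: "\<one>\<^bsub>presented_group R\<^esub> = {w. pres_eq R [] w}"
    by (simp add: presented_group_def)
  show "\<one>\<^bsub>presented_group R\<^esub> \<in> carrier (presented_group R)"
    by (auto simp: one carrier_presented_group)
  show "A \<otimes>\<^bsub>presented_group R\<^esub> B \<in> carrier (presented_group R)"
    if "A \<in> carrier (presented_group R)" "B \<in> carrier (presented_group R)" for A B
    using that by (auto simp: carrier_presented_group presented_group_mult_class)
  show "A \<otimes>\<^bsub>presented_group R\<^esub> B \<otimes>\<^bsub>presented_group R\<^esub> C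
      = A \<otimes>\<^bsub>presented_group R\<^esub> (B \<otimes>\<^bsub>presented_group R\<^esub> C)"
    if "A \<in> carrier (presented_group R)" "B \<in> carrier (presented_group R)"
      "C \<in> carrier (presented_group R)" for A B C
    using that by (auto simp: carrier_presented_group presented_group_mult_class)
  show "\<one>\<^bsub>presented_group R\<^esub> \<otimes>\<^bsub>presented_group R\<^esub> A = A"
    if "A \<in> carrier (presented_group R)" for A
    using that by (auto simp: one carrier_presented_group presented_group_mult_class)
  show "\<exists>B\<in>carrier (presented_group R). B \<otimes>\<^bsub>presented_group R\<^esub> A = \<one>\<^bsub>presented_group R\<^esub>"
    if A: "A \<in> carrier (presented_group R)" for A
  proof -
    obtain u where u: "A = {w. pres_eq R u w}"
      using A by (auto simp: carrier_presented_group)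
    let ?v = "rev (map (\<lambda>(g, b). (g, \<not> b)) u)"
    have "{w. pres_eq R (?v @ u) w} = {w. pres_eq R [] w}"
      using presented_group_word_inverse[of R u] by (auto intro: pres_trans pres_sym)
    then have "{w. pres_eq R ?v w} \<otimes>\<^bsub>presented_group R\<^esub> A = \<one>\<^bsub>presented_group R\<^esub>"
      by (simp add: u one presented_group_mult_class)
    then show ?thesis
      by (auto simp: carrier_presented_group)
  qed
qed

datatype dicyclic_gen = GenX | GenY

definition dicyclic_group :: "nat \<Rightarrow> dicyclic_gen word set monoid" where
  "dicyclic_group n = presented_group
    {(replicate (2 * n) (GenX, True), []),
     (replicate n (GenX, True), [(GenY, True), (GenY, True)]),
     ([(GenY, True), (GenX, True)], [(GenX, False), (GenY, True)])}"

text \<open>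
  Simple undirected graphs are digraphs satisfying the locale \<open>graph\<close>: every undirected edge is
  represented by its two orientations.
\<close>

definition generating_graph :: "('a, 'b) monoid_scheme \<Rightarrow> ('a, 'a \<times> 'a) pre_digraph" where
  "generating_graph G =
    \<lparr> verts = carrier G,
      arcs = {(g, h). g \<in> carrier G \<and> h \<in> carrier G \<and> g \<noteq> h \<and> generate G {g, h} = carrier G},
      tail = fst, head = snd \<rparr>"

definition remove_isolated :: "('a, 'b) pre_digraph \<Rightarrow> ('a, 'b) pre_digraph" where
  "remove_isolated G = G \<restriction> {v \<in> verts G. in_arcs G v \<noteq> {} \<or> out_arcs G v \<noteq> {}}"

definition graph_dist :: "('a, 'b) pre_digraph \<Rightarrow> 'a \<Rightarrow> 'a \<Rightarrow> nat" where
  "graph_dist G u v = (LEAST l. \<exists>p. pre_digraph.apath G u p v \<and> length p = l)"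

definition distance_matrix :: "('a, 'b) pre_digraph \<Rightarrow> 'a list \<Rightarrow> real mat" where
  "distance_matrix G vs =
    mat (length vs) (length vs) (\<lambda>(i, j). real (graph_dist G (vs ! i) (vs ! j)))"

text \<open>
  The distance spectrum is only defined for connected (finite, simple) graphs. Eigenvalues are
  counted with their multiplicity as roots of the characteristic polynomial; since distance matrices
  are real symmetric, all eigenvalues are real and this is also the geometric multiplicity. The
  multiset does not depend on the enumeration \<open>vs\<close> of the vertices.
\<close>

definition has_distance_spectrum :: "('a, 'b) pre_digraph \<Rightarrow> real multiset \<Rightarrow> bool" where
  "has_distance_spectrum G M \<longleftrightarrow>
    graph G \<and> Digraph_Component.connected G \<and>
    (\<forall>vs. distinct vs \<and> set vs = verts G \<longrightarrow> proots (char_poly (distance_matrix G vs)) = M)"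

definition moebius_mu :: "nat \<Rightarrow> int" where
  "moebius_mu m = (if squarefree m then (-1) ^ card (prime_factors m) else 0)"

end

(*
  Idea. Q_n consists of the elements X i = x^i and Y i = x^i y with i modulo 2n; distinctness is
  read off a multiplication on pairs that respects the relations. The pair {X i, Y j} generates
  iff gcd(i, n) = 1, {Y i, Y j} generates iff gcd(i - j, n) = 1, and {X i, X j} never does. So the
  nonisolated vertices are 2 phi(n) powers of x, pairwise at distance 2, and the 2n elements Y j,
  at distance 1 from the former, which among themselves carry a circulant distance matrix
  2J - 2I - A, where A is the circulant of the condition gcd(i - j, n) = 1. The characters of
  Z/2n diagonalise A; its eigenvalue at an even character 2c is twice the Ramanujan sum, that is
  2 mu(t) phi(n) / phi(t) with t = n / gcd(n, c), and it vanishes at odd characters because of the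
  shift by n. Characters that are nontrivial on one block and zero on the other are eigenvectors
  of the whole matrix; the two remaining eigenvectors are constant on the blocks and come from the
  2 x 2 quotient matrix.
*)
theory Submission
  imports Defs
begin

section \<open>The dicyclic group\<close>

text \<open>No eigenspace dimension is ever computed. The 2 phi(n) + 2 n eigenvectors are nonzero
  and pairwise orthogonal, and there are as many of them as vertices, so the change of basis has an
  explicit inverse and the characteristic polynomial gets one linear factor per vector, even where
  eigenvalues coincide. On the powers of x the distance block is 2J - 2I, for which every vector of
  sum 0 is an eigenvector. The characters of Z/2phi(n), on an arbitrary numbering of these vertices,
  serve only as an explicit orthogonal basis; they have no relation to the group. The multiplicity
  of -2: among the even characters 2c with 0 < c < n, each divisor t > 1 of n occurs phi(t) times,
  and mu(t) = 0 unless t divides n_0. Since phi sums to m over the divisors of m, exactly n - n_0 of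
  them give -2. The n odd characters and the 2 phi(n) - 1 nontrivial characters on the powers of x
  supply the rest of 2 (phi(n) + n) - n_0 - 1.\<close>

lemma presented_group_class_eqI:
  "pres_eq R u v \<Longrightarrow> {w. pres_eq R u w} = {w. pres_eq R v w}"
  by (auto intro: pres_sym pres_trans)

lemma presented_group_one: "\<one>\<^bsub>presented_group R\<^esub> = {w. pres_eq R [] w}"
  by (simp add: presented_group_def)

lemma presented_group_pow_class:
  "{w. pres_eq R [a] w} [^]\<^bsub>presented_group R\<^esub> (k::nat) = {w. pres_eq R (replicate k a) w}"
proof -
  interpret group "presented_group R" by (rule group_presented_group)
  show ?thesis
  proof (induction k)
    case (Suc k)
    then show ?case
      by (simp add: presented_group_mult_class replicate_append_same)
  qed (simp add: presented_group_one)
qed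

section \<open>Model of the normal forms by integer pairs\<close>

definition dicyclic_rels :: "nat \<Rightarrow> (dicyclic_gen word \<times> dicyclic_gen word) set" where
  "dicyclic_rels n =
    {(replicate (2 * n) (GenX, True), []),
     (replicate n (GenX, True), [(GenY, True), (GenY, True)]),
     ([(GenY, True), (GenX, True)], [(GenX, False), (GenY, True)])}"

text \<open>
  The pair \<open>(a, s)\<close>, with \<open>a\<close> meant modulo \<open>2 n\<close>, stands for \<open>x\<^sup>a y\<^sup>s\<close>. The value of a word in this model is
  invariant under the relations, so it tells the normal forms apart.
\<close>

fun dic_mult :: "nat \<Rightarrow> int \<times> bool \<Rightarrow> int \<times> bool \<Rightarrow> int \<times> bool" where
  "dic_mult n (a, s) (b, t) =
    (a + (if s then - b else b) + (if s \<and> t then int n else 0), s \<noteq> t)"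

text \<open>Since y^2 = x^n and x^(2n) = 1, the inverse of y is x^n y; this is the value
  \<open>int n\<close> for the letter \<open>(GenY, False)\<close>.\<close>

fun dic_letter :: "nat \<Rightarrow> dicyclic_gen \<times> bool \<Rightarrow> int \<times> bool" where
  "dic_letter n (GenX, b) = ((if b then 1 else -1), False)"
| "dic_letter n (GenY, b) = ((if b then 0 else int n), True)"

definition dic_eval :: "nat \<Rightarrow> dicyclic_gen word \<Rightarrow> int \<times> bool" where
  "dic_eval n u = foldr (dic_mult n \<circ> dic_letter n) u (0, False)"

definition dic_cong :: "nat \<Rightarrow> int \<times> bool \<Rightarrow> int \<times> bool \<Rightarrow> bool" where
  "dic_cong n p q \<longleftrightarrow> 2 * int n dvd fst p - fst q \<and> snd p = snd q"

lemma dic_cong_refl: "dic_cong n p p"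
  by (simp add: dic_cong_def)

lemma dic_cong_sym: "dic_cong n p q \<Longrightarrow> dic_cong n q p"
  by (auto simp: dic_cong_def dvd_diff_commute)

lemma dic_cong_trans: 
  assumes "dic_cong n p q" "dic_cong n q r" shows "dic_cong n p r"
proof -
  have "2 * int n dvd (fst p - fst q) + (fst q - fst r)"
    using assms unfolding dic_cong_def by (intro dvd_add) auto
  then show ?thesis using assms by (simp add: dic_cong_def)
qed

lemma dic_cong_mult:
  assumes "dic_cong n p p'" "dic_cong n q q'"
  shows "dic_cong n (dic_mult n p q) (dic_mult n p' q')"
proof -
  obtain a s b t a' b' where [simp]: "p = (a, s)" "q = (b, t)" "p' = (a', s)" "q' = (b', t)"
    using assms by (cases p; cases q; cases p'; cases q') (auto simp: dic_cong_def)
  have "2 * int n dvd (a - a') + (b - b')" "2 * int n dvd (a - a') - (b - b')"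
    using assms unfolding dic_cong_def by (auto intro: dvd_add dvd_diff)
  then show ?thesis
    by (auto simp: dic_cong_def algebra_simps)
qed

text \<open>Associativity holds only modulo 2n: for three factors with a y, the n coming from y^2
  enters with opposite signs on the two sides.\<close>

lemma dic_cong_assoc:
  "dic_cong n (dic_mult n (dic_mult n p q) r) (dic_mult n p (dic_mult n q r))"
  by (cases p; cases q; cases r) (auto simp: dic_cong_def)

lemma dic_eval_append:
  "dic_cong n (dic_eval n (u @ v)) (dic_mult n (dic_eval n u) (dic_eval n v))"
proof (induction u)
  case Nil
  show ?case by (cases "dic_eval n v") (simp add: dic_eval_def dic_cong_refl)
next
  case (Cons a u)
  have *: "dic_eval n (a # w) = dic_mult n (dic_letter n a) (dic_eval n w)" for w
    by (simp add: dic_eval_def)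
  show ?case
    unfolding append_Cons *
    by (meson Cons dic_cong_assoc dic_cong_mult dic_cong_refl dic_cong_sym dic_cong_trans)
qed

lemma dic_eval_replicate_X: "dic_eval n (replicate k (GenX, True)) = (int k, False)"
  by (induction k) (auto simp: dic_eval_def)

lemma dic_eval_pres_eq:
  "pres_eq (dicyclic_rels n) u v \<Longrightarrow> dic_cong n (dic_eval n u) (dic_eval n v)"
proof (induction rule: pres_eq.induct)
  case (pres_rel u v)
  then show ?case
    by (auto simp: dicyclic_rels_def dic_eval_replicate_X dic_cong_def)
       (auto simp: dic_eval_def)
next
  case (pres_cancel g b)
  show ?case by (cases g; cases b) (auto simp: dic_eval_def dic_cong_def)
next
  case (pres_append u u' v v')
  then show ?case
    by (meson dic_eval_append dic_cong_mult dic_cong_sym dic_cong_trans)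
qed (auto intro: dic_cong_refl dic_cong_sym dic_cong_trans)

lemma dicyclic_group_alt: "dicyclic_group n = presented_group (dicyclic_rels n)"
  by (simp add: dicyclic_group_def dicyclic_rels_def)

section \<open>The elements x^i and x^i y and their multiplication table\<close>

definition dic_x :: "nat \<Rightarrow> dicyclic_gen word set" where
  "dic_x n = {w. pres_eq (dicyclic_rels n) [(GenX, True)] w}"

definition dic_y :: "nat \<Rightarrow> dicyclic_gen word set" where
  "dic_y n = {w. pres_eq (dicyclic_rels n) [(GenY, True)] w}"

text \<open>Integer exponents make inversion a change of sign; the period 2n is then a congruence of
  indices.\<close>

definition dicX :: "nat \<Rightarrow> int \<Rightarrow> dicyclic_gen word set" where
  "dicX n i = dic_x n [^]\<^bsub>dicyclic_group n\<^esub> i"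

definition dicY :: "nat \<Rightarrow> int \<Rightarrow> dicyclic_gen word set" where
  "dicY n i = dicX n i \<otimes>\<^bsub>dicyclic_group n\<^esub> dic_y n"

context
  fixes n :: nat and G
  defines "G \<equiv> dicyclic_group n"
begin

interpretation group G
  unfolding G_def dicyclic_group_alt by (rule group_presented_group)

lemma dic_x_carrier: "dic_x n \<in> carrier G"
  by (auto simp: dic_x_def G_def dicyclic_group_alt carrier_presented_group)

lemma dic_y_carrier: "dic_y n \<in> carrier G"
  by (auto simp: dic_y_def G_def dicyclic_group_alt carrier_presented_group)

lemma dicX_carrier [simp]: "dicX n i \<in> carrier G"
  using dic_x_carrier by (simp add: dicX_def G_def[symmetric])

lemma dicY_carrier [simp]: "dicY n i \<in> carrier G"
  using dic_y_carrier by (simp add: dicY_def G_def[symmetric])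

lemma dicX_nat: "dicX n (int k) = {w. pres_eq (dicyclic_rels n) (replicate k (GenX, True)) w}"
  unfolding dicX_def int_pow_int dic_x_def dicyclic_group_alt by (rule presented_group_pow_class)

lemma dicX_0 [simp]: "dicX n 0 = \<one>\<^bsub>G\<^esub>"
  by (simp add: dicX_def G_def[symmetric])

lemma dicX_1: "dicX n 1 = dic_x n"
  using dic_x_carrier by (simp add: dicX_def G_def[symmetric])

lemma dicX_mult: "dicX n i \<otimes>\<^bsub>G\<^esub> dicX n j = dicX n (i + j)"
  using dic_x_carrier by (simp add: dicX_def G_def[symmetric] int_pow_mult)

lemma dicX_inv: "inv\<^bsub>G\<^esub> (dicX n i) = dicX n (- i)"
  using dic_x_carrier by (simp add: dicX_def G_def[symmetric] int_pow_neg)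

lemma dicX_period: "dicX n (2 * int n * k) = \<one>\<^bsub>G\<^esub>"
proof -
  have "dicX n (int (2 * n)) = {w. pres_eq (dicyclic_rels n) [] w}"
    unfolding dicX_nat
    by (intro presented_group_class_eqI pres_rel) (simp add: dicyclic_rels_def)
  then have "dicX n (2 * int n) = \<one>\<^bsub>G\<^esub>"
    by (simp add: G_def dicyclic_group_alt presented_group_one)
  moreover have "dicX n (2 * int n * k) = dicX n (2 * int n) [^]\<^bsub>G\<^esub> k"
    using dic_x_carrier by (simp add: dicX_def G_def[symmetric] int_pow_pow)
  ultimately show ?thesis by simp
qed

lemma dicX_cong:
  assumes "2 * int n dvd i - j" shows "dicX n i = dicX n j"
proof -
  obtain k where "i = j + 2 * int n * k" using assms by (auto simp: dvd_def algebra_simps)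
  then show ?thesis using dicX_mult[of j "2 * int n * k"] by (simp add: dicX_period)
qed

lemma dicY_cong: "2 * int n dvd i - j \<Longrightarrow> dicY n i = dicY n j"
  unfolding dicY_def using dicX_cong by metis

lemma dic_y_square: "dic_y n \<otimes>\<^bsub>G\<^esub> dic_y n = dicX n (int n)"
  unfolding dicX_nat dic_y_def G_def dicyclic_group_alt presented_group_mult_class
  by (intro presented_group_class_eqI pres_sym[OF pres_rel]) (simp add: dicyclic_rels_def)

lemma dic_x_inv: "inv\<^bsub>G\<^esub> (dic_x n) = {w. pres_eq (dicyclic_rels n) [(GenX, False)] w}"
proof (rule inv_equality)
  show "{w. pres_eq (dicyclic_rels n) [(GenX, False)] w} \<otimes>\<^bsub>G\<^esub> dic_x n = \<one>\<^bsub>G\<^esub>"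
    unfolding dic_x_def G_def dicyclic_group_alt presented_group_mult_class presented_group_one
    using pres_cancel[of "dicyclic_rels n" GenX False]
    by (intro presented_group_class_eqI) simp
qed (use dic_x_carrier in \<open>auto simp: G_def dicyclic_group_alt carrier_presented_group\<close>)

lemma dic_y_x: "dic_y n \<otimes>\<^bsub>G\<^esub> dic_x n = dicX n (- 1) \<otimes>\<^bsub>G\<^esub> dic_y n"
proof -
  have "dicX n (- 1) = inv\<^bsub>G\<^esub> (dic_x n)"
    using dicX_inv[of 1] dicX_1 by simp
  then have X: "dicX n (- 1) = {w. pres_eq (dicyclic_rels n) [(GenX, False)] w}"
    by (simp add: dic_x_inv)
  show ?thesis
    unfolding X dic_x_def dic_y_def G_def dicyclic_group_alt presented_group_mult_class
    by (intro presented_group_class_eqI pres_rel) (simp add: dicyclic_rels_def)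
qed

lemma dic_y_X_nat: "dic_y n \<otimes>\<^bsub>G\<^esub> dicX n (int k) = dicX n (- int k) \<otimes>\<^bsub>G\<^esub> dic_y n"
proof (induction k)
  case 0
  show ?case by (simp add: dic_y_carrier)
next
  case (Suc k)
  have "dic_y n \<otimes>\<^bsub>G\<^esub> dicX n (int (Suc k)) = dic_y n \<otimes>\<^bsub>G\<^esub> dicX n (int k) \<otimes>\<^bsub>G\<^esub> dicX n 1"
    by (simp add: m_assoc dic_y_carrier dicX_mult add.commute)
  also have "\<dots> = dicX n (- int k) \<otimes>\<^bsub>G\<^esub> (dic_y n \<otimes>\<^bsub>G\<^esub> dic_x n)"
    by (simp add: Suc m_assoc dic_y_carrier dic_x_carrier dicX_1)
  also have "\<dots> = dicX n (- int (Suc k)) \<otimes>\<^bsub>G\<^esub> dic_y n"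
    unfolding dic_y_x by (simp add: m_assoc[symmetric] dic_y_carrier dicX_mult algebra_simps)
  finally show ?case .
qed

lemma dic_y_X: "dic_y n \<otimes>\<^bsub>G\<^esub> dicX n i = dicX n (- i) \<otimes>\<^bsub>G\<^esub> dic_y n"
proof (cases "i \<ge> 0")
  case True
  then show ?thesis using dic_y_X_nat[of "nat i"] by simp
next
  case False
  then have *: "dic_y n \<otimes>\<^bsub>G\<^esub> dicX n (- i) = dicX n i \<otimes>\<^bsub>G\<^esub> dic_y n"
    using dic_y_X_nat[of "nat (- i)"] by simp
  \<comment> \<open>The factor x^(-i) x^i = 1 is inserted before y; the case of the positive
    exponent -i moves x^i past y, where it cancels.\<close>
  have "dic_y n \<otimes>\<^bsub>G\<^esub> dicX n i = dicX n (- i) \<otimes>\<^bsub>G\<^esub> (dicX n i \<otimes>\<^bsub>G\<^esub> dic_y n) \<otimes>\<^bsub>G\<^esub> dicX n i"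
    by (simp add: m_assoc[symmetric] dic_y_carrier dicX_mult)
  also have "\<dots> = dicX n (- i) \<otimes>\<^bsub>G\<^esub> dic_y n"
    unfolding *[symmetric] by (simp add: m_assoc dic_y_carrier dicX_mult)
  finally show ?thesis .
qed

lemma dicXY_mult: "dicX n i \<otimes>\<^bsub>G\<^esub> dicY n j = dicY n (i + j)"
  by (simp add: dicY_def G_def[symmetric] m_assoc[symmetric] dic_y_carrier dicX_mult)

lemma dicYX_mult: "dicY n i \<otimes>\<^bsub>G\<^esub> dicX n j = dicY n (i - j)"
  by (simp add: dicY_def G_def[symmetric] m_assoc dic_y_carrier dic_y_X)
     (simp add: m_assoc[symmetric] dic_y_carrier dicX_mult)

lemma dicYY_mult: "dicY n i \<otimes>\<^bsub>G\<^esub> dicY n j = dicX n (i - j + int n)"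
proof -
  have "dicY n i \<otimes>\<^bsub>G\<^esub> dicY n j = dicY n i \<otimes>\<^bsub>G\<^esub> dicX n j \<otimes>\<^bsub>G\<^esub> dic_y n"
    by (simp add: dicY_def[of n j] G_def[symmetric] m_assoc[symmetric] dic_y_carrier)
  also have "\<dots> = dicX n (i - j) \<otimes>\<^bsub>G\<^esub> (dic_y n \<otimes>\<^bsub>G\<^esub> dic_y n)"
    unfolding dicYX_mult by (simp add: dicY_def G_def[symmetric] m_assoc dic_y_carrier)
  finally show ?thesis by (simp add: dic_y_square dicX_mult)
qed

lemma dicY_inv: "inv\<^bsub>G\<^esub> (dicY n i) = dicY n (i + int n)"
  by (rule inv_equality) (auto simp: dicYY_mult dicX_period[of 1, simplified])

text \<open>Each letter is itself a normal form (x, x^(-1), y, or y^(-1) = x^n y), so by the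
  multiplication table prefixing a letter keeps a word in normal form.\<close>

lemma dicyclic_carrier: "carrier G = range (dicX n) \<union> range (dicY n)"
proof
  have "{w. pres_eq (dicyclic_rels n) u w} \<in> range (dicX n) \<union> range (dicY n)" for u
  proof (induction u)
    case Nil
    have "dicX n 0 = {w. pres_eq (dicyclic_rels n) [] w}" using dicX_nat[of 0] by simp
    then show ?case by blast
  next
    case (Cons a u)
    have 1: "{w. pres_eq (dicyclic_rels n) (a # u) w} =
        {w. pres_eq (dicyclic_rels n) [a] w} \<otimes>\<^bsub>G\<^esub> {w. pres_eq (dicyclic_rels n) u w}"
      by (simp add: G_def dicyclic_group_alt presented_group_mult_class)
    have "{w. pres_eq (dicyclic_rels n) [(GenY, False)] w} = inv\<^bsub>G\<^esub> (dic_y n)"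
    proof (rule inv_equality[symmetric])
      show "{w. pres_eq (dicyclic_rels n) [(GenY, False)] w} \<otimes>\<^bsub>G\<^esub> dic_y n = \<one>\<^bsub>G\<^esub>"
        unfolding dic_y_def G_def dicyclic_group_alt presented_group_mult_class presented_group_one
        using pres_cancel[of "dicyclic_rels n" GenY False]
        by (intro presented_group_class_eqI) simp
    qed (use dic_y_carrier in \<open>auto simp: G_def dicyclic_group_alt carrier_presented_group\<close>)
    moreover have y: "dic_y n = dicY n 0" by (simp add: dicY_def G_def[symmetric] dic_y_carrier)
    moreover have "{w. pres_eq (dicyclic_rels n) [(GenX, False)] w} = dicX n (- 1)"
      using dic_x_inv dicX_1 dicX_inv[of 1] by simp
    ultimately have 2: "{w. pres_eq (dicyclic_rels n) [a] w} \<in> {dicX n 1, dicX n (- 1), dicY n 0, dicY n (int n)}"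
      using dicY_inv[of 0] dicX_1
      by (cases a; cases "fst a"; cases "snd a") (auto simp: dic_x_def[symmetric] dic_y_def[symmetric])
    show ?case
      unfolding 1 using 2 Cons by (auto simp: dicX_mult dicXY_mult dicYX_mult dicYY_mult)
  qed
  then show "carrier G \<subseteq> range (dicX n) \<union> range (dicY n)"
    by (auto simp: G_def dicyclic_group_alt carrier_presented_group)
qed auto

lemma class_dic_cong:
  assumes "{w. pres_eq (dicyclic_rels n) u w} = {w. pres_eq (dicyclic_rels n) v w}"
  shows "dic_cong n (dic_eval n u) (dic_eval n v)"
  using assms by (intro dic_eval_pres_eq) (use pres_refl in blast)

section \<open>Equality of normal forms, and pairs that generate\<close>

context
  assumes n_pos: "n > 0"
begin

lemma dicX_mod: "dicX n i = dicX n (int (nat (i mod (2 * int n))))"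
  using n_pos by (intro dicX_cong) (simp add: minus_mod_eq_mult_div[symmetric])

text \<open>Only nonnegative powers come with an explicit word, so the exponent is first reduced
  modulo 2n, which \<open>dic_cong\<close> does not see.\<close>

lemma dicX_eval:
  obtains u where "dicX n i = {w. pres_eq (dicyclic_rels n) u w}" "dic_cong n (dic_eval n u) (i, False)"
proof
  show "dicX n i = {w. pres_eq (dicyclic_rels n) (replicate (nat (i mod (2 * int n))) (GenX, True)) w}"
    by (subst dicX_mod) (rule dicX_nat)
  have "2 * int n dvd i mod (2 * int n) - i"
    by (metis dvd_diff_commute minus_mod_eq_mult_div dvd_triv_left)
  then show "dic_cong n (dic_eval n (replicate (nat (i mod (2 * int n))) (GenX, True))) (i, False)"
    using n_pos by (simp add: dic_eval_replicate_X dic_cong_def)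
qed

lemma dicY_eval:
  obtains u where "dicY n i = {w. pres_eq (dicyclic_rels n) u w}" "dic_cong n (dic_eval n u) (i, True)"
proof -
  obtain u where u: "dicX n i = {w. pres_eq (dicyclic_rels n) u w}" "dic_cong n (dic_eval n u) (i, False)"
    by (rule dicX_eval)
  show ?thesis
  proof
    show "dicY n i = {w. pres_eq (dicyclic_rels n) (u @ [(GenY, True)]) w}"
      by (simp add: dicY_def u dic_y_def dicyclic_group_alt presented_group_mult_class)
    have "dic_eval n [(GenY, True)] = (0, True)" by (simp add: dic_eval_def)
    then have "dic_cong n (dic_eval n (u @ [(GenY, True)])) (dic_mult n (dic_eval n u) (0, True))"
      using dic_eval_append[of n u "[(GenY, True)]"] by simp
    moreover have "dic_cong n (dic_mult n (dic_eval n u) (0, True)) (dic_mult n (i, False) (0, True))"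
      by (intro dic_cong_mult u dic_cong_refl)
    ultimately show "dic_cong n (dic_eval n (u @ [(GenY, True)])) (i, True)"
      using dic_cong_trans by fastforce
  qed
qed

lemma dicX_eq_iff: "dicX n i = dicX n j \<longleftrightarrow> 2 * int n dvd i - j"
proof
  assume "dicX n i = dicX n j"
  obtain u where u: "dicX n i = {w. pres_eq (dicyclic_rels n) u w}" "dic_cong n (dic_eval n u) (i, False)"
    by (rule dicX_eval)
  obtain v where v: "dicX n j = {w. pres_eq (dicyclic_rels n) v w}" "dic_cong n (dic_eval n v) (j, False)"
    by (rule dicX_eval)
  have "dic_cong n (i, False) (j, False)"
    using u v \<open>dicX n i = dicX n j\<close> class_dic_cong dic_cong_sym dic_cong_trans by metis
  then show "2 * int n dvd i - j" by (simp add: dic_cong_def)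
qed (rule dicX_cong)

lemma dicX_neq_dicY: "dicX n i \<noteq> dicY n j"
proof
  assume "dicX n i = dicY n j"
  obtain u where u: "dicX n i = {w. pres_eq (dicyclic_rels n) u w}" "dic_cong n (dic_eval n u) (i, False)"
    by (rule dicX_eval)
  obtain v where v: "dicY n j = {w. pres_eq (dicyclic_rels n) v w}" "dic_cong n (dic_eval n v) (j, True)"
    by (rule dicY_eval)
  have "dic_cong n (i, False) (j, True)"
    using u v \<open>dicX n i = dicY n j\<close> class_dic_cong dic_cong_sym dic_cong_trans by metis
  then show False by (simp add: dic_cong_def)
qed

lemma dicY_eq_iff: "dicY n i = dicY n j \<longleftrightarrow> 2 * int n dvd i - j"
proof
  assume "dicY n i = dicY n j"
  then have "dicX n i = dicX n j"
    unfolding dicY_def G_def[symmetric] by (simp add: dic_y_carrier)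
  then show "2 * int n dvd i - j" by (simp add: dicX_eq_iff)
qed (rule dicY_cong)

text \<open>For \<open>g\<close> dividing \<open>n\<close> this is the subgroup generated by \<open>x\<^sup>g\<close> and \<open>x\<^sup>j y\<close>.\<close>

definition dic_sub :: "int \<Rightarrow> int \<Rightarrow> dicyclic_gen word set set" where
  "dic_sub g j = dicX n ` {a. g dvd a} \<union> dicY n ` {b. g dvd b - j}"

text \<open>Inverting or multiplying elements of the form x^b y shifts exponents by n, so closure
  rests on g dividing n.\<close>

lemma dic_sub_subgroup:
  assumes "g dvd int n" shows "subgroup (dic_sub g j) G"
proof (rule subgroupI)
  show "dic_sub g j \<subseteq> carrier G" by (auto simp: dic_sub_def)
  show "dic_sub g j \<noteq> {}" by (auto simp: dic_sub_def)
  show "inv\<^bsub>G\<^esub> a \<in> dic_sub g j" if "a \<in> dic_sub g j" for a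
  proof -
    have "g dvd b + int n - j" if "g dvd b - j" for b
      using dvd_add[OF that assms] by (simp add: algebra_simps)
    then show ?thesis
      using that by (auto simp: dic_sub_def dicX_inv dicY_inv)
  qed
  show "a \<otimes>\<^bsub>G\<^esub> b \<in> dic_sub g j" if "a \<in> dic_sub g j" "b \<in> dic_sub g j" for a b
  proof -
    have 1: "g dvd a + b - j" if "g dvd a" "g dvd b - j" for a b
      using dvd_add[OF that] by (simp add: algebra_simps)
    have 2: "g dvd a - b - j" if "g dvd a - j" "g dvd b" for a b
      using dvd_diff[OF that] by (simp add: algebra_simps)
    have 3: "g dvd a - b + int n" if "g dvd a - j" "g dvd b - j" for a b
      using dvd_add[OF dvd_diff[OF that] assms] by (simp add: algebra_simps)
    show ?thesis
      using that 1 2 3 by (auto simp: dic_sub_def dicX_mult dicXY_mult dicYX_mult dicYY_mult)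
  qed
qed

lemma dic_sub_proper:
  assumes "g dvd int n" "dic_sub g j = carrier G"
  shows "is_unit g"
proof -
  have "dicX n 1 \<in> dic_sub g j" using assms by simp
  then obtain a where "g dvd a" "dicX n 1 = dicX n a"
    using dicX_neq_dicY by (auto simp: dic_sub_def)
  then have "2 * int n dvd 1 - a" by (simp add: dicX_eq_iff)
  then have "g dvd 1 - a" using assms(1) by (metis dvd_mult dvd_trans)
  then have "g dvd (1 - a) + a" using \<open>g dvd a\<close> by (rule dvd_add)
  then show ?thesis by simp
qed

text \<open>A generating set cannot lie in a proper subgroup. For a mixed pair i is the exponent of
  the power of x; for two elements x^i y, x^j y it is the difference of exponents.\<close>

lemma generate_eq_carrier_imp_coprime:
  assumes "generate G S = carrier G" "S \<subseteq> dic_sub (gcd i (int n)) j"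
  shows "coprime i (int n)"
proof -
  have "carrier G \<subseteq> dic_sub (gcd i (int n)) j"
    using generate_subgroup_incl[OF assms(2) dic_sub_subgroup] assms(1) by simp
  moreover have "dic_sub (gcd i (int n)) j \<subseteq> carrier G"
    by (rule subgroup.subset[OF dic_sub_subgroup]) simp
  ultimately have "is_unit (gcd i (int n))"
    by (intro dic_sub_proper) auto
  then show ?thesis by (simp add: coprime_iff_gcd_eq_1)
qed

text \<open>The square of x^j y is x^n, so Bezout for i and n puts x into H, and x together with x^j
  y reaches every normal form.\<close>

lemma generateI_coprime:
  assumes "coprime i (int n)" "dicX n i \<in> H" "dicY n j \<in> H" "subgroup H G"
  shows "H = carrier G"
proof
  show "H \<subseteq> carrier G" using assms by (simp add: subgroup.subset)
  have pow: "dicX n (a * k) \<in> H" if "dicX n a \<in> H" for a k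
  proof -
    have "dicX n (a * k) = dicX n a [^]\<^bsub>G\<^esub> k"
      using dic_x_carrier by (simp add: dicX_def G_def[symmetric] int_pow_pow)
    then show ?thesis using subgroup_int_pow_closed[OF assms(4) that] by simp
  qed
  have "dicX n (int n) \<in> H"
    using subgroup.m_closed[OF assms(4,3,3)] by (simp add: dicYY_mult)
  obtain a b where ab: "a * i + b * int n = 1"
    using assms(1) by (metis bezout_int coprime_iff_gcd_eq_1)
  have "dicX n (i * a) \<otimes>\<^bsub>G\<^esub> dicX n (int n * b) \<in> H"
    using subgroup.m_closed[OF assms(4)] pow \<open>dicX n (int n) \<in> H\<close> assms(2) by blast
  then have "dicX n 1 \<in> H" using ab by (simp add: dicX_mult algebra_simps)
  then have X: "dicX n k \<in> H" for k using pow[of 1 k] by simp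
  have Y: "dicY n k \<in> H" for k
    using subgroup.m_closed[OF assms(4) X[of "k - j"] assms(3)] by (simp add: dicXY_mult)
  show "carrier G \<subseteq> H" using X Y by (auto simp: dicyclic_carrier)
qed

lemma generate_XX: "generate G {dicX n i, dicX n j} \<noteq> carrier G"
proof
  assume "generate G {dicX n i, dicX n j} = carrier G"
  moreover have "subgroup (range (dicX n)) G"
    by (rule subgroupI) (auto simp: dicX_inv dicX_mult)
  ultimately have "carrier G \<subseteq> range (dicX n)"
    using generate_subgroup_incl[of "{dicX n i, dicX n j}" "range (dicX n)"] by auto
  then have "dicY n 0 \<in> range (dicX n)" using dicY_carrier by blast
  then show False using dicX_neq_dicY by (metis imageE)
qed

lemma generate_XY: "generate G {dicX n i, dicY n j} = carrier G \<longleftrightarrow> coprime i (int n)"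
proof
  assume "generate G {dicX n i, dicY n j} = carrier G"
  then show "coprime i (int n)"
    by (rule generate_eq_carrier_imp_coprime[where j = j]) (auto simp: dic_sub_def)
next
  assume "coprime i (int n)"
  then show "generate G {dicX n i, dicY n j} = carrier G"
    by (rule generateI_coprime) (auto intro: generate.incl generate_is_subgroup)
qed

lemma generate_YY: "generate G {dicY n i, dicY n j} = carrier G \<longleftrightarrow> coprime (i - j) (int n)"
proof
  assume "generate G {dicY n i, dicY n j} = carrier G"
  then show "coprime (i - j) (int n)"
    by (rule generate_eq_carrier_imp_coprime[where j = j]) (auto simp: dic_sub_def)
next
  assume cop: "coprime (i - j) (int n)"
  have sub: "subgroup (generate G {dicY n i, dicY n j}) G"
    by (rule generate_is_subgroup) auto
  \<comment> \<open>The product supplies a power of x whose exponent differs from i - j by n, which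
    does not affect coprimality to n.\<close>
  have "dicY n i \<otimes>\<^bsub>G\<^esub> dicY n j \<in> generate G {dicY n i, dicY n j}"
    by (rule subgroup.m_closed[OF sub]) (auto intro: generate.incl)
  then have X: "dicX n (i - j + int n) \<in> generate G {dicY n i, dicY n j}"
    by (simp add: dicYY_mult)
  have "coprime (i - j + int n) (int n)"
    using cop by (simp add: coprime_iff_gcd_eq_1)
  then show "generate G {dicY n i, dicY n j} = carrier G"
    by (rule generateI_coprime[OF _ X _ sub, where j = j]) (auto intro: generate.incl)
qed

end
end

section \<open>The generating graph\<close>

context wf_digraph
begin

lemma awalk_length_0: "awalk u p v \<Longrightarrow> length p = 0 \<Longrightarrow> u = v"
  by (simp add: awalk_def)

lemma awalk_length_1: "awalk u p v \<Longrightarrow> length p = Suc 0 \<Longrightarrow> u \<rightarrow> v"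
  by (auto simp: awalk_def length_Suc_conv arcs_ends_conv)

lemma graph_dist_refl: "u \<in> verts G \<Longrightarrow> graph_dist G u u = 0"
  unfolding graph_dist_def by (rule Least_eq_0) (auto simp: apath_Nil_iff)

lemma graph_dist_eq_1:
  assumes "u \<rightarrow> v" "u \<noteq> v"
  shows "graph_dist G u v = 1"
  unfolding graph_dist_def
proof (rule Least_equality)
  obtain e where "e \<in> arcs G" "tail G e = u" "head G e = v"
    using assms(1) by (rule reachableE)
  then have "apath u [e] v" using assms(2) by (auto simp: apath_def awalk_def)
  then show "\<exists>p. apath u p v \<and> length p = 1" by force
  show "1 \<le> l" if "\<exists>p. apath u p v \<and> length p = l" for l
    using that awalk_length_0 assms(2) by (cases l) (auto simp: apath_def)
qed

lemma graph_dist_eq_2: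
  assumes "u \<rightarrow> w" "w \<rightarrow> v" "\<not> u \<rightarrow> v" "u \<noteq> v"
  shows "graph_dist G u v = 2"
  unfolding graph_dist_def
proof (rule Least_equality)
  obtain e where e: "e \<in> arcs G" "tail G e = u" "head G e = w"
    using assms(1) by (rule reachableE)
  obtain f where f: "f \<in> arcs G" "tail G f = w" "head G f = v"
    using assms(2) by (rule reachableE)
  \<comment> \<open>An \<open>apath\<close> must not repeat vertices; if w were u or v, one of the
    two edges would already join u to v.\<close>
  have "w \<noteq> u" "w \<noteq> v" using assms by auto
  then have "apath u [e, f] v" using assms(4) e f by (auto simp: apath_def awalk_def)
  then show "\<exists>p. apath u p v \<and> length p = 2" by force
  show "2 \<le> l" if l: "\<exists>p. apath u p v \<and> length p = l" for l
  proof (rule ccontr)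
    assume "\<not> 2 \<le> l"
    then have "l = 0 \<or> l = Suc 0" by auto
    then show False using l awalk_length_0 awalk_length_1 assms(3,4) by (auto simp: apath_def)
  qed
qed

end

text \<open>Endpoints of an edge are not isolated, so no edge of the generating graph is
  lost.\<close>

lemma dominates_remove_isolated:
  "g \<rightarrow>\<^bsub>remove_isolated (generating_graph G)\<^esub> h \<longleftrightarrow>
    g \<in> carrier G \<and> h \<in> carrier G \<and> g \<noteq> h \<and> generate G {g, h} = carrier G"
  unfolding arcs_ends_conv
  by (auto simp: remove_isolated_def generating_graph_def in_arcs_def out_arcs_def image_iff)

text \<open>Both orientations of every edge are present, so an out-neighbour exists as soon as any
  arc touches the vertex.\<close>

lemma verts_remove_isolated:
  "g \<in> verts (remove_isolated (generating_graph G)) \<longleftrightarrow>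
    (\<exists>h. g \<rightarrow>\<^bsub>remove_isolated (generating_graph G)\<^esub> h)"
  unfolding dominates_remove_isolated
  by (auto simp: remove_isolated_def generating_graph_def in_arcs_def out_arcs_def insert_commute)

lemma graph_remove_isolated_generating_graph:
  assumes "finite (carrier G)"
  shows "graph (remove_isolated (generating_graph G))"
proof -
  let ?E = "arcs (remove_isolated (generating_graph G))"
  have "?E \<subseteq> carrier G \<times> carrier G"
    by (auto simp: remove_isolated_def generating_graph_def)
  then have "finite ?E" using assms by (meson finite_SigmaI finite_subset)
  moreover have "symmetric (remove_isolated (generating_graph G))"
    unfolding symmetric_def by (rule symI) (auto simp: dominates_remove_isolated insert_commute)
  ultimately show ?thesis
    using assms
    by unfold_locales
      (auto simp: remove_isolated_def generating_graph_def in_arcs_def out_arcs_def arc_to_ends_def)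
qed

section \<open>Adjacency, distances and connectedness for the dicyclic group\<close>

context
  fixes n :: nat
  assumes n_pos: "n > 0"
begin

abbreviation (input) "dic_graph \<equiv> remove_isolated (generating_graph (dicyclic_group n))"

lemma dominates_dic_XX: "\<not> dicX n i \<rightarrow>\<^bsub>dic_graph\<^esub> dicX n j"
  using generate_XX[OF n_pos] by (auto simp: dominates_remove_isolated)

lemma dominates_dic_XY: "dicX n i \<rightarrow>\<^bsub>dic_graph\<^esub> dicY n j \<longleftrightarrow> coprime i (int n)"
  using generate_XY[OF n_pos] dicX_neq_dicY[OF n_pos] by (auto simp: dominates_remove_isolated)

lemma dominates_dic_YX: "dicY n j \<rightarrow>\<^bsub>dic_graph\<^esub> dicX n i \<longleftrightarrow> coprime i (int n)"
  using dominates_dic_XY by (auto simp: dominates_remove_isolated insert_commute)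

lemma dominates_dic_YY:
  "dicY n i \<rightarrow>\<^bsub>dic_graph\<^esub> dicY n j \<longleftrightarrow> \<not> 2 * int n dvd i - j \<and> coprime (i - j) (int n)"
  using generate_YY[OF n_pos] dicY_eq_iff[OF n_pos] by (auto simp: dominates_remove_isolated)

lemma dicX_in_verts: "dicX n i \<in> verts dic_graph \<longleftrightarrow> coprime i (int n)"
proof -
  have "dicX n i \<in> verts dic_graph \<longleftrightarrow> (\<exists>h\<in>carrier (dicyclic_group n). dicX n i \<rightarrow>\<^bsub>dic_graph\<^esub> h)"
    by (auto simp: verts_remove_isolated dominates_remove_isolated)
  then show ?thesis
    by (simp add: dicyclic_carrier bex_Un dominates_dic_XX dominates_dic_XY)
qed

lemma dicY_in_verts: "dicY n i \<in> verts dic_graph"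
  unfolding verts_remove_isolated using dominates_dic_YX[of i 1] by auto

lemma dicX_modulo: "dicX n (i mod (2 * int n)) = dicX n i"
  by (rule dicX_cong) (metis dvd_diff_commute dvd_triv_left minus_mod_eq_mult_div)

lemma dicY_modulo: "dicY n (i mod (2 * int n)) = dicY n i"
  by (rule dicY_cong) (metis dvd_diff_commute dvd_triv_left minus_mod_eq_mult_div)

lemma range_dicX: "range (dicX n) = dicX n ` {0..<2 * int n}"
proof (intro equalityI subsetI)
  fix g assume "g \<in> range (dicX n)"
  then obtain i where "g = dicX n (i mod (2 * int n))" by (auto simp: dicX_modulo)
  moreover have "i mod (2 * int n) \<in> {0..<2 * int n}" using n_pos by simp
  ultimately show "g \<in> dicX n ` {0..<2 * int n}" by blast
qed auto

lemma range_dicY: "range (dicY n) = dicY n ` {0..<2 * int n}"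
proof (intro equalityI subsetI)
  fix g assume "g \<in> range (dicY n)"
  then obtain i where "g = dicY n (i mod (2 * int n))" by (auto simp: dicY_modulo)
  moreover have "i mod (2 * int n) \<in> {0..<2 * int n}" using n_pos by simp
  ultimately show "g \<in> dicY n ` {0..<2 * int n}" by blast
qed auto

lemma graph_dic_graph: "graph dic_graph"
  by (rule graph_remove_isolated_generating_graph) (simp add: dicyclic_carrier range_dicX range_dicY)

interpretation graph dic_graph by (rule graph_dic_graph)

lemma verts_dic_graph:
  "verts dic_graph = dicX n ` {i \<in> {0..<2 * int n}. coprime i (int n)} \<union> dicY n ` {0..<2 * int n}"
proof -
  have "verts dic_graph \<subseteq> carrier (dicyclic_group n)"
    by (auto simp: verts_remove_isolated dominates_remove_isolated)
  then show ?thesis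
    using dicX_in_verts dicY_in_verts unfolding dicyclic_carrier range_dicX range_dicY by blast
qed

text \<open>All surviving powers of x have the common neighbour y.\<close>

lemma dist_dic_XX:
  assumes "coprime i (int n)" "coprime j (int n)"
  shows "graph_dist dic_graph (dicX n i) (dicX n j) = (if 2 * int n dvd i - j then 0 else 2)"
proof (cases "2 * int n dvd i - j")
  case True
  then have "dicX n i = dicX n j" by (rule dicX_cong)
  then show ?thesis using True assms by (simp add: graph_dist_refl dicX_in_verts)
next
  case False
  then show ?thesis
    using graph_dist_eq_2[of "dicX n i" "dicY n 0" "dicX n j"] assms
    by (simp add: dominates_dic_XX dominates_dic_XY dominates_dic_YX dicX_eq_iff[OF n_pos])
qed

lemma dist_dic_XY:
  assumes "coprime i (int n)"
  shows "graph_dist dic_graph (dicX n i) (dicY n j) = 1" "graph_dist dic_graph (dicY n j) (dicX n i) = 1"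
  using assms dicX_neq_dicY[OF n_pos]
  by (auto intro!: graph_dist_eq_1 simp: dominates_dic_XY dominates_dic_YX simp del: One_nat_def)

text \<open>All elements x^j y have the common neighbour x, so nonadjacent ones are at distance
  2.\<close>

lemma dist_dic_YY:
  "graph_dist dic_graph (dicY n i) (dicY n j) =
    (if 2 * int n dvd i - j then 0 else if coprime (i - j) (int n) then 1 else 2)"
proof (cases "2 * int n dvd i - j")
  case True
  then have "dicY n i = dicY n j" by (rule dicY_cong)
  then show ?thesis using True by (simp add: graph_dist_refl dicY_in_verts)
next
  case False
  then show ?thesis
    using graph_dist_eq_2[of "dicY n i" "dicX n 1" "dicY n j"] graph_dist_eq_1[of "dicY n i" "dicY n j"]
    by (simp add: dominates_dic_YY dominates_dic_XY dominates_dic_YX dicY_eq_iff[OF n_pos])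
qed

lemma connected_dic_graph: "Digraph_Component.connected dic_graph"
  unfolding connected_def
proof (rule strongly_connectedI)
  show "verts (with_proj (mk_symmetric dic_graph)) \<noteq> {}"
    using dicY_in_verts by auto
  fix u v assume "u \<in> verts (with_proj (mk_symmetric dic_graph))" "v \<in> verts (with_proj (mk_symmetric dic_graph))"
  then have uv: "u \<in> verts dic_graph" "v \<in> verts dic_graph" by auto
  \<comment> \<open>The vertex x is a hub: every x^j y is adjacent to it, and the other powers of x
    reach it through y.\<close>
  have Y1: "dicX n 1 \<rightarrow>\<^sup>*\<^bsub>dic_graph\<^esub> dicY n j" "dicY n j \<rightarrow>\<^sup>*\<^bsub>dic_graph\<^esub> dicX n 1" for j
    using dominates_dic_XY[of 1 j] dominates_dic_YX[of j 1] by auto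
  have "dicX n i \<rightarrow>\<^sup>*\<^bsub>dic_graph\<^esub> dicY n 0" "dicY n 0 \<rightarrow>\<^sup>*\<^bsub>dic_graph\<^esub> dicX n i" if "coprime i (int n)" for i
    using dominates_dic_XY[of i 0] dominates_dic_YX[of 0 i] that by auto
  then have "w \<rightarrow>\<^sup>*\<^bsub>dic_graph\<^esub> dicX n 1" "dicX n 1 \<rightarrow>\<^sup>*\<^bsub>dic_graph\<^esub> w" if "w \<in> verts dic_graph" for w
    using that Y1 reachable_trans unfolding verts_dic_graph by blast+
  then have "u \<rightarrow>\<^sup>*\<^bsub>dic_graph\<^esub> v"
    using uv reachable_trans by blast
  then show "u \<rightarrow>\<^sup>*\<^bsub>with_proj (mk_symmetric dic_graph)\<^esub> v"
    by (rule reachable_mk_symmetricI)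
qed

end

section \<open>Spectra from orthogonal eigenvectors\<close>

lemma proots_prod_linear:
  "finite B \<Longrightarrow> proots (\<Prod>b\<in>B. [:- l b, 1:]) = image_mset l (mset_set B)"
  for l :: "'b \<Rightarrow> 'a :: idom"
  by (subst proots_prod) (auto simp: sum_unfold_sum_mset sum_mset_singleton_mset)

lemma inj_map_poly_of_real: "map_poly complex_of_real p = map_poly of_real q \<Longrightarrow> p = q"
  by (rule poly_eqI) (metis of_real_hom.coeff_map_poly_hom of_real_eq_iff)

text \<open>The eigenvectors form the columns of P. By orthogonality the conjugate transpose, with
  rows divided by the squared norms, is the inverse Q, so the matrix is similar to a diagonal one
  and repeated values of l are counted correctly.\<close>

lemma proots_char_poly_orthogonal_eigenvectors:
  fixes D :: "'a \<Rightarrow> 'a \<Rightarrow> real" and f :: "'b \<Rightarrow> 'a \<Rightarrow> complex" and l :: "'b \<Rightarrow> real"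
  assumes vs: "distinct vs" and B: "finite B" "card B = length vs"
    and eig: "\<And>b v. b \<in> B \<Longrightarrow> v \<in> set vs \<Longrightarrow>
      (\<Sum>w\<in>set vs. of_real (D v w) * f b w) = of_real (l b) * f b v"
    and orth: "\<And>b c. b \<in> B \<Longrightarrow> c \<in> B \<Longrightarrow> b \<noteq> c \<Longrightarrow> (\<Sum>v\<in>set vs. f b v * cnj (f c v)) = 0"
    and nz: "\<And>b. b \<in> B \<Longrightarrow> (\<Sum>v\<in>set vs. f b v * cnj (f b v)) \<noteq> 0"
  shows "proots (char_poly (mat (length vs) (length vs) (\<lambda>(i, j). D (vs ! i) (vs ! j))))
    = image_mset l (mset_set B)"
proof -
  obtain bs where bs: "distinct bs" "set bs = B"
    using finite_distinct_list[OF B(1)] by blast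
  define N where "N = length vs"
  have len: "length bs = N" using bs B(2) distinct_card N_def by metis
  have sum_vs: "(\<Sum>w\<in>set vs. F w) = (\<Sum>i = 0..<N. F (vs ! i))" for F :: "'a \<Rightarrow> complex"
    using vs by (simp add: sum.distinct_set_conv_list sum_list_sum_nth N_def)
  define A where "A = mat N N (\<lambda>(i, j). D (vs ! i) (vs ! j))"
  define nrm where "nrm b = (\<Sum>v\<in>set vs. f b v * cnj (f b v))" for b
  define P where "P = mat N N (\<lambda>(i, j). f (bs ! j) (vs ! i))"
  define Q where "Q = mat N N (\<lambda>(j, i). cnj (f (bs ! j) (vs ! i)) / nrm (bs ! j))"
  define L where "L = mat_diag N (\<lambda>j. complex_of_real (l (bs ! j)))"
  let ?A = "map_mat complex_of_real A"
  have carr: "A \<in> carrier_mat N N" "?A \<in> carrier_mat N N" "P \<in> carrier_mat N N"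
    "Q \<in> carrier_mat N N" "L \<in> carrier_mat N N"
    by (auto simp: A_def P_def Q_def L_def)
  have bsB: "bs ! j \<in> B" if "j < N" for j using that bs len nth_mem by blast
  have vsv: "vs ! j \<in> set vs" if "j < N" for j using that by (simp add: N_def)
  have QP: "Q * P = 1\<^sub>m N"
  proof (rule eq_matI)
    fix i j assume "i < dim_row (1\<^sub>m N :: complex mat)" "j < dim_col (1\<^sub>m N :: complex mat)"
    then have ij: "i < N" "j < N" by auto
    have "(Q * P) $$ (i, j) = (\<Sum>k = 0..<N. cnj (f (bs ! i) (vs ! k)) / nrm (bs ! i) * f (bs ! j) (vs ! k))"
      using ij by (simp add: P_def Q_def scalar_prod_def)
    also have "\<dots> = (\<Sum>v\<in>set vs. f (bs ! j) v * cnj (f (bs ! i) v)) / nrm (bs ! i)"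
      unfolding sum_vs sum_divide_distrib by (intro sum.cong) auto
    also have "\<dots> = (if i = j then 1 else 0)"
      using ij orth[OF bsB[of j] bsB[of i]] nz[OF bsB[of i]] bs len
      by (auto simp: nrm_def nth_eq_iff_index_eq)
    finally show "(Q * P) $$ (i, j) = 1\<^sub>m N $$ (i, j)" using ij by simp
  qed (use carr in auto)
  have PQ: "P * Q = 1\<^sub>m N"
    by (rule mat_mult_left_right_inverse[OF carr(4,3) QP])
  have AP: "?A * P = P * L"
  proof (rule eq_matI)
    fix i j assume "i < dim_row (P * L)" "j < dim_col (P * L)"
    then have ij: "i < N" "j < N" using carr by auto
    have "(?A * P) $$ (i, j) = (\<Sum>k = 0..<N. of_real (D (vs ! i) (vs ! k)) * f (bs ! j) (vs ! k))"
      using ij by (simp add: P_def A_def scalar_prod_def)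
    also have "\<dots> = of_real (l (bs ! j)) * f (bs ! j) (vs ! i)"
      using eig[OF bsB vsv, of j i] ij unfolding sum_vs by simp
    also have "\<dots> = (P * L) $$ (i, j)"
      unfolding L_def mat_diag_mult_right[OF carr(3)] using ij by (simp add: P_def)
    finally show "(?A * P) $$ (i, j) = (P * L) $$ (i, j)" .
  qed (use carr in auto)
  have "?A = ?A * (P * Q)" using carr PQ by simp
  also have "\<dots> = ?A * P * Q" by (rule assoc_mult_mat[OF carr(2,3,4), symmetric])
  also have "\<dots> = P * L * Q" by (simp only: AP)
  finally have "similar_mat ?A L"
    unfolding similar_mat_def using similar_mat_witI[OF PQ QP _ carr(2,5,3,4)] by blast
  \<comment> \<open>The eigenvectors are complex but the matrix and l are real: the polynomial
    identity is proved over the complex numbers and pulled back by injectivity.\<close>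
  then have "map_poly complex_of_real (char_poly A) = char_poly L"
    using char_poly_similar of_real_hom.char_poly_hom[OF carr(1)] by metis
  also have "\<dots> = (\<Prod>a\<leftarrow>diag_mat L. [:- a, 1:])"
    by (rule char_poly_upper_triangular[OF carr(5)]) (auto simp: L_def mat_diag_def)
  also have "diag_mat L = map (\<lambda>b. of_real (l b)) bs"
    unfolding diag_mat_def by (rule nth_equalityI) (auto simp: L_def mat_diag_def len)
  also have "(\<Prod>a\<leftarrow>map (\<lambda>b. complex_of_real (l b)) bs. [:- a, 1:]) = map_poly of_real (\<Prod>b\<leftarrow>bs. [:- l b, 1:])"
  proof (induction bs)
    case (Cons b bs)
    interpret map_poly_comm_ring_hom complex_of_real ..
    have "map_poly complex_of_real [:- l b, 1:] = [:- of_real (l b), 1:]" by simp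
    then show ?case
      using Cons by (simp only: list.map prod_list.Cons hom_mult)
  qed simp
  finally have "char_poly A = (\<Prod>b\<leftarrow>bs. [:- l b, 1:])"
    by (rule inj_map_poly_of_real)
  also have "\<dots> = (\<Prod>b\<in>B. [:- l b, 1:])"
    using bs by (metis prod.distinct_set_conv_list)
  finally show ?thesis
    unfolding A_def N_def by (simp add: proots_prod_linear B(1))
qed

section \<open>Ramanujan sums\<close>

definition unit_root :: "nat \<Rightarrow> int \<Rightarrow> complex" where
  "unit_root N a = cis (2 * pi * (of_int a / of_nat N))"

lemma unit_root_0 [simp]: "unit_root N 0 = 1"
  by (simp add: unit_root_def)

lemma unit_root_add: "unit_root N (a + b) = unit_root N a * unit_root N b"
  by (simp add: unit_root_def cis_mult add_divide_distrib distrib_left)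

lemma cnj_unit_root: "cnj (unit_root N a) = unit_root N (- a)"
  by (simp add: unit_root_def cis_cnj)

lemma unit_root_mult_cancel: "k > 0 \<Longrightarrow> unit_root (k * N) (int k * a) = unit_root N a"
  by (simp add: unit_root_def)

lemma unit_root_eq_1_iff:
  assumes "N > 0" shows "unit_root N a = 1 \<longleftrightarrow> int N dvd a"
proof
  assume "unit_root N a = 1"
  then have "cos (2 * pi * (of_int a / of_nat N)) = 1"
    by (simp add: unit_root_def complex_eq_iff)
  then obtain k :: int where "2 * pi * (of_int a / of_nat N) = of_int k * 2 * pi"
    by (auto simp: cos_one_2pi_int)
  then have "real_of_int a = of_int k * of_nat N"
    using assms by (simp add: field_simps)
  then have "a = k * int N" by (metis of_int_eq_iff of_int_mult of_int_of_nat_eq)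
  then show "int N dvd a" by simp
next
  assume "int N dvd a"
  then obtain k where "a = int N * k" by auto
  then show "unit_root N a = 1" using assms by (simp add: unit_root_def cis_multiple_2pi)
qed

lemma unit_root_cong:
  assumes "N > 0" "int N dvd a - b" shows "unit_root N a = unit_root N b"
  using unit_root_add[of N "a - b" b] unit_root_eq_1_iff[OF assms(1), of "a - b"] assms by simp

text \<open>Modulo N the map h is an injection of a finite set into itself, hence permutes the
  residues. It will be a translation or the multiplication by a unit.\<close>

lemma sum_periodic_reindex:
  fixes g :: "int \<Rightarrow> 'a :: comm_monoid_add"
  assumes "N > 0" and per: "\<And>i j. int N dvd i - j \<Longrightarrow> g i = g j"
    and inj: "\<And>i j. int N dvd h i - h j \<Longrightarrow> int N dvd i - j"
  shows "(\<Sum>j\<in>{0..<int N}. g (h j)) = (\<Sum>j\<in>{0..<int N}. g j)"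
proof -
  let ?h = "\<lambda>j. h j mod int N"
  have "inj_on ?h {0..<int N}"
  proof (rule inj_onI)
    fix i j assume ij: "i \<in> {0..<int N}" "j \<in> {0..<int N}" "?h i = ?h j"
    then have "int N dvd i - j" using inj by (metis mod_eq_dvd_iff)
    then have "i mod int N = j mod int N" by (simp add: mod_eq_dvd_iff)
    then show "i = j" using ij by simp
  qed
  moreover have "?h ` {0..<int N} \<subseteq> {0..<int N}" using assms(1) by auto
  ultimately have bij: "bij_betw ?h {0..<int N} {0..<int N}"
    by (simp add: bij_betw_def endo_inj_surj)
  have "(\<Sum>j\<in>{0..<int N}. g (h j)) = (\<Sum>j\<in>{0..<int N}. g (?h j))"
    by (intro sum.cong refl per) (simp add: minus_mod_eq_mult_div)
  also have "\<dots> = (\<Sum>j\<in>{0..<int N}. g j)"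
    by (rule sum.reindex_bij_betw[OF bij])
  finally show ?thesis .
qed

lemma sum_periodic_shift:
  fixes g :: "int \<Rightarrow> 'a :: comm_monoid_add"
  assumes "N > 0" and "\<And>i j. int N dvd i - j \<Longrightarrow> g i = g j"
  shows "(\<Sum>j\<in>{0..<int N}. g (j + m)) = (\<Sum>j\<in>{0..<int N}. g j)"
  by (rule sum_periodic_reindex[OF assms]) auto

text \<open>The shift permutes the terms and multiplies the sum by z, so S = z S. Every vanishing
  character sum below comes from here.\<close>

lemma sum_shift_eigenfunction_eq_0:
  fixes g :: "int \<Rightarrow> complex"
  assumes "N > 0" and "\<And>i j. int N dvd i - j \<Longrightarrow> g i = g j"
    and "\<And>j. g (j + m) = z * g j" "z \<noteq> 1"
  shows "(\<Sum>j\<in>{0..<int N}. g j) = 0"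
proof -
  have "(\<Sum>j\<in>{0..<int N}. g j) = (\<Sum>j\<in>{0..<int N}. g (j + m))"
    by (rule sum_periodic_shift[OF assms(1,2), symmetric])
  also have "\<dots> = z * (\<Sum>j\<in>{0..<int N}. g j)"
    by (simp add: assms(3) sum_distrib_left)
  finally show ?thesis using assms(4) by simp
qed

lemma sum_unit_root_eq_0:
  assumes "N > 0" "\<not> int N dvd a"
  shows "(\<Sum>j\<in>{0..<int N}. unit_root N (a * j)) = 0"
proof (rule sum_shift_eigenfunction_eq_0[where m = 1 and z = "unit_root N a"])
  show "unit_root N (a * i) = unit_root N (a * j)" if "int N dvd i - j" for i j
    using that assms by (intro unit_root_cong) (auto simp: right_diff_distrib[symmetric])
qed (use assms in \<open>auto simp: unit_root_eq_1_iff unit_root_add distrib_left\<close>)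

lemma coprime_int_cong:
  fixes i j m :: int
  assumes "m dvd i - j" shows "coprime i m \<longleftrightarrow> coprime j m"
proof -
  have "i mod m = j mod m" using assms by (simp add: mod_eq_dvd_iff)
  then show ?thesis by (metis coprime_mod_left_iff coprime_0_right_iff mod_by_0 assms)
qed

text \<open>Shifting by m preserves coprimality to m and multiplies each root by the m-th power of a
  primitive t-th root of unity, which is not 1 as 0 < m < t.\<close>

lemma sum_coprime_unit_root_eq_0:
  assumes "m dvd t" "m < t"
  shows "(\<Sum>j\<in>{0..<int t}. if coprime j (int m) then unit_root t j else 0) = 0"
proof (rule sum_shift_eigenfunction_eq_0[where m = "int m" and z = "unit_root t (int m)"])
  show t: "t > 0" using assms by simp
  fix i j
  show "(if coprime i (int m) then unit_root t i else 0) =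
      (if coprime j (int m) then unit_root t j else 0)" if "int t dvd i - j"
  proof -
    have "int m dvd i - j" using that assms(1) by (meson dvd_trans int_dvd_int_iff)
    then show ?thesis using coprime_int_cong[of "int m" i j] unit_root_cong[OF t that] by simp
  qed
next
  fix j
  show "(if coprime (j + int m) (int m) then unit_root t (j + int m) else 0) =
      unit_root t (int m) * (if coprime j (int m) then unit_root t j else 0)"
    using coprime_int_cong[of "int m" "j + int m" j] by (simp add: unit_root_add)
next
  have "m > 0" using assms by (metis dvd_0_left_iff gr_zeroI not_less_zero)
  then show "unit_root t (int m) \<noteq> 1"
    using assms by (auto simp: unit_root_eq_1_iff dest: dvd_imp_le)
qed

lemma moebius_mu_prime_mult:
  assumes "prime p" "m > 0"
  shows "moebius_mu (p * m) = (if p dvd m then 0 else - moebius_mu m)"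
proof (cases "p dvd m")
  case True
  then have "p\<^sup>2 dvd p * m" by (simp add: power2_eq_square)
  then have "\<not> squarefree (p * m)"
    using assms(1) by (meson not_prime_unit squarefree_def)
  then show ?thesis using True by (simp add: moebius_mu_def)
next
  case False
  then have "coprime p m" using assms(1) by (simp add: prime_imp_coprime)
  moreover have "prime_factors (p * m) = insert p (prime_factors m)"
    using assms by (auto simp: prime_factors_product prime_prime_factors)
  moreover have "p \<notin> prime_factors m" using False by auto
  moreover have "squarefree (p * m) \<longleftrightarrow> squarefree m"
    using \<open>coprime p m\<close> assms(1) squarefree_multD[of p m]
    by (metis squarefree_mult_coprime squarefree_prime)
  ultimately show ?thesis
    using False by (simp add: moebius_mu_def)
qed

text \<open>
  Dropping one prime \<open>p\<close> from the coprimality condition makes the sum vanish, since its terms are then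
  multiplied by a nontrivial root of unity under a shift; this relates the sums for \<open>t\<close> and \<open>t / p\<close>.
\<close>

lemma sum_primitive_unit_roots:
  "t > 0 \<Longrightarrow> (\<Sum>j\<in>{0..<int t}. if coprime j (int t) then unit_root t j else 0) = of_int (moebius_mu t)"
proof (induction t rule: less_induct)
  case (less t)
  show ?case
  proof (cases "t = 1")
    case True
    have "{0..<1::int} = {0}" by auto
    then show ?thesis using True by (simp add: moebius_mu_def)
  next
    case False
    then obtain p where p: "prime p" "p dvd t" using prime_factor_nat by blast
    then obtain m where t: "t = p * m" by auto
    have m: "m > 0" "m < t" using less.prems p(1) prime_gt_1_nat t by auto
    have zero: "(\<Sum>j\<in>{0..<int t}. if coprime j (int m) then unit_root t j else 0) = 0"
      using m t by (intro sum_coprime_unit_root_eq_0) auto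
    have cop: "coprime j (int t) \<longleftrightarrow> \<not> int p dvd j \<and> coprime j (int m)" for j
    proof -
      have "coprime j (int p) \<longleftrightarrow> \<not> int p dvd j"
        using p(1) prime_imp_coprime[of "int p" j] coprime_common_divisor[of j "int p" "int p"]
        by (metis coprime_commute dvd_refl not_prime_unit prime_nat_int_transfer)
      then show ?thesis by (simp add: t)
    qed
    show ?thesis
    proof (cases "p dvd m")
      case True
      then have "coprime j (int t) \<longleftrightarrow> coprime j (int m)" for j
        using cop[of j] coprime_common_divisor[of j "int m" "int p"] p(1)
        by (metis int_dvd_int_iff not_prime_unit prime_nat_int_transfer)
      then show ?thesis
        using zero True moebius_mu_prime_mult[OF p(1) m(1)] t by simp
    next
      case False
      let ?g = "\<lambda>j. if coprime j (int m) then unit_root t j else 0"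
      have img: "{0..<int t} \<inter> {j. int p dvd j} = (*) (int p) ` {0..<int m}" (is "?A = ?B")
      proof
        show "?A \<subseteq> ?B"
        proof
          fix j assume "j \<in> ?A"
          then obtain i where "j = int p * i" "0 \<le> int p * i" "int p * i < int p * int m"
            by (auto simp: t)
          then show "j \<in> ?B"
            using p(1) prime_gt_0_nat[OF p(1)] by (auto simp: zero_le_mult_iff)
        qed
        show "?B \<subseteq> ?A" using prime_gt_0_nat[OF p(1)] by (auto simp: t)
      qed
      have "coprime (int p) (int m)" using False p(1) by (simp add: prime_imp_coprime)
      \<comment> \<open>The terms to be discarded are those with p dividing j. As p is prime to m,
        writing j = p i turns them into the sum for m, known by induction.\<close>
      have "(\<Sum>j\<in>{0..<int t} \<inter> {j. int p dvd j}. ?g j) = (\<Sum>i\<in>{0..<int m}. ?g (int p * i))"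
        unfolding img using prime_gt_0_nat[OF p(1)] by (subst sum.reindex) (auto intro: inj_onI)
      also have "\<dots> = (\<Sum>i\<in>{0..<int m}. if coprime i (int m) then unit_root m i else 0)"
        using \<open>coprime (int p) (int m)\<close> prime_gt_0_nat[OF p(1)]
        by (intro sum.cong) (auto simp: t unit_root_mult_cancel)
      also have "\<dots> = of_int (moebius_mu m)" using less.IH m by blast
      finally have 1: "(\<Sum>j\<in>{0..<int t} \<inter> {j. int p dvd j}. ?g j) = of_int (moebius_mu m)" .
      have "(\<Sum>j\<in>{0..<int t}. if coprime j (int t) then unit_root t j else 0)
          = (\<Sum>j\<in>{0..<int t} - {j. int p dvd j}. ?g j)"
        by (rule sum.mono_neutral_cong_right) (auto simp: cop)
      also have "\<dots> = (\<Sum>j\<in>{0..<int t}. ?g j) - (\<Sum>j\<in>{0..<int t} \<inter> {j. int p dvd j}. ?g j)"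
        by (subst sum.Int_Diff[of "{0..<int t}" _ "{j. int p dvd j}"]) auto
      finally show ?thesis
        using 1 zero False moebius_mu_prime_mult[OF p(1) m(1)] t by simp
    qed
  qed
qed

section \<open>Units modulo n over units modulo a divisor, and the closed form of the sums\<close>

text \<open>With w the product of the primes of n that do not divide u, every prime of n divides
  exactly one of u and t w, hence not their sum.\<close>

lemma coprime_lift:
  fixes u t n :: int
  assumes "coprime u t" "n \<noteq> 0"
  obtains u' where "t dvd u' - u" "coprime u' n"
proof -
  define w where "w = \<Prod>{p \<in> prime_factors n. \<not> p dvd u}"
  have "coprime (u + t * w) n"
  proof (rule ccontr)
    assume "\<not> coprime (u + t * w) n"
    then obtain p where p: "prime p" "p dvd u + t * w" "p dvd n"
      using assms(2) prime_divisor_exists[of "gcd (u + t * w) n"] by auto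
    show False
    proof (cases "p dvd u")
      case True
      then have "p dvd t * w" using p(2) by (metis dvd_add_right_iff)
      moreover have "\<not> p dvd t" using assms(1) True p(1) by (meson coprime_common_divisor not_prime_unit)
      ultimately have "p dvd w" using p(1) by (simp add: prime_dvd_mult_iff)
      then obtain q where "q \<in> prime_factors n" "\<not> q dvd u" "p dvd q"
        using p(1) by (auto simp: w_def prime_dvd_prod_iff)
      then show False using True p(1) primes_dvd_imp_eq by blast
    next
      case False
      then have "p dvd w"
        using p assms(2) by (auto simp: w_def in_prime_factors_iff intro!: dvd_prodI)
      then have "p dvd u" using p(2) by (metis dvd_add_left_iff dvd_mult)
      then show False using False by simp
    qed
  qed
  then show ?thesis using that[of "u + t * w"] by simp
qed

lemma sum_coprime_eq_totient:
  assumes "n > 0"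
  shows "(\<Sum>j\<in>{0..<int n}. if coprime j (int n) then 1 else 0) = (of_nat (totient n) :: complex)"
proof -
  have "card {j\<in>{0..<int n}. coprime j (int n)} = totient n"
  \<comment> \<open>\<open>totatives n\<close> lies in 1..n, the sum runs over 0..n-1. The two index
    sets differ only for n = 1, where 0 takes the place of 1.\<close>
  proof (cases "n = 1")
    case True
    have "{j\<in>{0..<1::int}. coprime j 1} = {0}" by auto
    then show ?thesis using True by simp
  next
    case False
    have "{j\<in>{0..<int n}. coprime j (int n)} = int ` totatives n"
    proof (intro equalityI subsetI)
      fix j assume j: "j \<in> {j\<in>{0..<int n}. coprime j (int n)}"
      then have "j \<noteq> 0" using False by (intro notI) simp
      moreover obtain k where "j = int k" using j nonneg_int_cases by auto
      ultimately show "j \<in> int ` totatives n"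
        using j by (auto simp: totatives_def)
    next
      fix j assume "j \<in> int ` totatives n"
      then show "j \<in> {j\<in>{0..<int n}. coprime j (int n)}"
        using totatives_less[of _ n] False assms by (auto simp: totatives_def)
    qed
    then show ?thesis by (simp add: card_image totient_def)
  qed
  then show ?thesis by (simp add: sum.If_cases Int_def)
qed

lemma sum_coprime_mult_reindex:
  fixes F :: "int \<Rightarrow> 'a :: comm_monoid_add"
  assumes "n > 0" "coprime u (int n)" and per: "\<And>i j. int n dvd i - j \<Longrightarrow> F i = F j"
  shows "(\<Sum>j\<in>{0..<int n}. if coprime j (int n) then F (u * j) else 0)
    = (\<Sum>j\<in>{0..<int n}. if coprime j (int n) then F j else 0)"
proof -
  have "(\<Sum>j\<in>{0..<int n}. if coprime j (int n) then F (u * j) else 0)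
    = (\<Sum>j\<in>{0..<int n}. if coprime (u * j) (int n) then F (u * j) else 0)"
    using assms(2) by (intro sum.cong) auto
  also have "\<dots> = (\<Sum>j\<in>{0..<int n}. if coprime j (int n) then F j else 0)"
  proof (rule sum_periodic_reindex[OF assms(1), where h = "(*) u" and
        g = "\<lambda>j. if coprime j (int n) then F j else 0"])
    show "(if coprime i (int n) then F i else 0) = (if coprime j (int n) then F j else 0)"
      if "int n dvd i - j" for i j
      using coprime_int_cong[OF that] per[OF that] by simp
    show "int n dvd i - j" if "int n dvd u * i - u * j" for i j
      using that assms(2) by (simp add: right_diff_distrib[symmetric] coprime_dvd_mult_right_iff coprime_commute)
  qed
  finally show ?thesis .
qed

text \<open>
  Both sides equal the sum of \<open>F (u * j)\<close> over the units \<open>u\<close> modulo \<open>t\<close> and \<open>j\<close> modulo \<open>n\<close>: every \<open>u\<close> lifts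
  to a unit modulo \<open>n\<close>, so that the inner sum over \<open>j\<close> does not depend on \<open>u\<close>.
\<close>

lemma sum_units_reduce:
  fixes F :: "int \<Rightarrow> complex"
  assumes "n > 0" "t dvd n" and per: "\<And>i j. int t dvd i - j \<Longrightarrow> F i = F j"
  shows "of_nat (totient t) * (\<Sum>j\<in>{0..<int n}. if coprime j (int n) then F j else 0)
    = of_nat (totient n) * (\<Sum>i\<in>{0..<int t}. if coprime i (int t) then F i else 0)"
    (is "_ * ?S = _ * ?T")
proof -
  have t: "t > 0" using assms by (metis dvd_0_left_iff gr0I)
  have pern: "F i = F j" if "int n dvd i - j" for i j
    using that assms(2) by (intro per) (meson dvd_trans int_dvd_int_iff)
  have S: "(\<Sum>j\<in>{0..<int n}. if coprime j (int n) then F (u * j) else 0) = ?S"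
    if u: "coprime u (int t)" for u
  proof -
    obtain u' where u': "int t dvd u' - u" "coprime u' (int n)"
      using coprime_lift[OF u, of "int n"] assms(1) by auto
    have "F (u * j) = F (u' * j)" for j
    proof (rule per)
      have "int t dvd (u' - u) * j" using u'(1) by simp
      then show "int t dvd u * j - u' * j"
        by (metis dvd_diff_commute left_diff_distrib)
    qed
    then have "(\<Sum>j\<in>{0..<int n}. if coprime j (int n) then F (u * j) else 0)
        = (\<Sum>j\<in>{0..<int n}. if coprime j (int n) then F (u' * j) else 0)"
      by (simp only:)
    also have "\<dots> = ?S" by (rule sum_coprime_mult_reindex[OF assms(1) u'(2) pern])
    finally show ?thesis .
  qed
  have T: "(\<Sum>u\<in>{0..<int t}. if coprime u (int t) then F (u * j) else 0) = ?T"
    if "coprime j (int n)" for j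
  proof -
    have "coprime j (int t)" using that assms(2)
      by (meson coprime_divisors dvd_refl int_dvd_int_iff)
    then show ?thesis
      unfolding mult.commute[of _ j] by (rule sum_coprime_mult_reindex[OF t _ per])
  qed
  have "of_nat (totient t) * ?S = (\<Sum>u\<in>{0..<int t}. if coprime u (int t) then ?S else 0)"
    unfolding sum_coprime_eq_totient[OF t, symmetric] sum_distrib_right
    by (intro sum.cong) auto
  also have "\<dots> = (\<Sum>u\<in>{0..<int t}. \<Sum>j\<in>{0..<int n}.
      if coprime u (int t) \<and> coprime j (int n) then F (u * j) else 0)"
    by (rule sum.cong[OF refl]) (use S in auto)
  also have "\<dots> = (\<Sum>j\<in>{0..<int n}. \<Sum>u\<in>{0..<int t}.
      if coprime u (int t) \<and> coprime j (int n) then F (u * j) else 0)"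
    by (rule sum.swap)
  also have "\<dots> = (\<Sum>j\<in>{0..<int n}. if coprime j (int n) then ?T else 0)"
    by (rule sum.cong[OF refl]) (use T in auto)
  also have "\<dots> = of_nat (totient n) * ?T"
    unfolding sum_coprime_eq_totient[OF assms(1), symmetric] sum_distrib_right
    by (intro sum.cong) auto
  finally show ?thesis .
qed

text \<open>Cancelling g = gcd(n, c) replaces c / n by c' / t with c' a unit modulo t. The unit
  drops out by reindexing, and each unit modulo t has phi(n) / phi(t) lifts to a unit modulo
  n.\<close>

lemma ramanujan_sum:
  assumes "n > 0" and t: "t = n div gcd n c"
  shows "(\<Sum>j\<in>{0..<int n}. if coprime j (int n) then unit_root n (int c * j) else 0)
    = of_int (moebius_mu t) * of_nat (totient n) / of_nat (totient t)"
proof -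
  define g where "g = gcd n c"
  obtain c' where c: "c = g * c'" by (metis dvdE g_def gcd_dvd2)
  have n: "n = g * t" by (simp add: t g_def)
  have pos: "g > 0" "t > 0" using assms(1) n by (auto intro!: gr0I)
  have "gcd (g * t) (g * c') = g" using g_def n c by simp
  then have "gcd t c' = 1" using pos(1) by (simp add: gcd_mult_distrib_nat[symmetric])
  then have c': "coprime (int c') (int t)"
    by (simp add: coprime_iff_gcd_eq_1 gcd.commute)
  have eq: "unit_root n (int c * j) = unit_root t (int c' * j)" for j
    using unit_root_mult_cancel[OF pos(1), of t "int c' * j"] by (simp add: n c mult.assoc)
  have per: "unit_root t (int c' * i) = unit_root t (int c' * j)" if "int t dvd i - j" for i j
    using that pos(2) by (intro unit_root_cong) (auto simp: right_diff_distrib[symmetric])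
  have "of_nat (totient t) * (\<Sum>j\<in>{0..<int n}. if coprime j (int n) then unit_root n (int c * j) else 0)
    = of_nat (totient n) * (\<Sum>j\<in>{0..<int t}. if coprime j (int t) then unit_root t (int c' * j) else 0)"
    unfolding eq by (rule sum_units_reduce[OF assms(1) _ per]) (auto simp: n)
  also have "(\<Sum>j\<in>{0..<int t}. if coprime j (int t) then unit_root t (int c' * j) else 0)
    = of_int (moebius_mu t)"
    using sum_coprime_mult_reindex[OF pos(2) c', of "unit_root t"] unit_root_cong[OF pos(2)]
      sum_primitive_unit_roots[OF pos(2)] by simp
  finally show ?thesis using pos(2) by (simp add: field_simps)
qed

section \<open>Eigenvectors of the distance matrix\<close>

lemma sum_double_period:
  fixes F :: "int \<Rightarrow> complex"
  assumes "\<And>i j. int n dvd i - j \<Longrightarrow> F i = F j"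
  shows "(\<Sum>j\<in>{0..<int (2 * n)}. F j) = 2 * (\<Sum>j\<in>{0..<int n}. F j)"
proof -
  have "{0..<int (2 * n)} = {0..<int n} \<union> {int n..<2 * int n}" by auto
  then have "(\<Sum>j\<in>{0..<int (2 * n)}. F j) = (\<Sum>j\<in>{0..<int n}. F j) + (\<Sum>j\<in>{int n..<2 * int n}. F j)"
    by (simp add: sum.union_disjoint)
  also have "(\<Sum>j\<in>{int n..<2 * int n}. F j) = (\<Sum>j\<in>{0..<int n}. F j)"
    by (rule sum.reindex_bij_witness[of _ "\<lambda>j. j + int n" "\<lambda>j. j - int n"]) (auto intro: assms)
  finally show ?thesis by simp
qed

lemma card_coprime_double:
  assumes "n > 0"
  shows "card {i\<in>{0..<2 * int n}. coprime i (int n)} = 2 * totient n"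
proof -
  have "of_nat (card {i\<in>{0..<2 * int n}. coprime i (int n)})
      = (\<Sum>j\<in>{0..<int (2 * n)}. if coprime j (int n) then 1 else (0::complex))"
    by (simp add: sum.If_cases Int_def)
  also have "\<dots> = 2 * (\<Sum>j\<in>{0..<int n}. if coprime j (int n) then 1 else 0)"
    by (rule sum_double_period) (simp add: coprime_int_cong)
  also have "\<dots> = of_nat (2 * totient n)"
    by (simp add: sum_coprime_eq_totient[OF assms])
  finally show ?thesis using of_nat_eq_iff by blast
qed

text \<open>For b = 2c the number \<open>nat b div 2\<close> is c. At b = 0 the gcd is n, so t = 1
  and the value is the row sum 2 phi(n).\<close>

definition circ_eigenvalue :: "nat \<Rightarrow> int \<Rightarrow> real" where
  "circ_eigenvalue n b = (if odd b then 0 else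
    (let t = n div gcd n (nat b div 2)
     in 2 * of_int (moebius_mu t) * (real (totient n) / real (totient t))))"

lemma sum_coprime_unit_root_double:
  assumes "n > 0" "b \<ge> 0"
  shows "(\<Sum>j\<in>{0..<int (2 * n)}. if coprime j (int n) then unit_root (2 * n) (b * j) else 0)
    = of_real (circ_eigenvalue n b)"
proof (cases "odd b")
  case True
  have "(\<Sum>j\<in>{0..<int (2 * n)}. if coprime j (int n) then unit_root (2 * n) (b * j) else 0) = 0"
  proof (rule sum_shift_eigenfunction_eq_0[where m = "int n" and z = "unit_root 2 b"])
    fix i j
    show "(if coprime i (int n) then unit_root (2 * n) (b * i) else 0) =
      (if coprime j (int n) then unit_root (2 * n) (b * j) else 0)" if *: "int (2 * n) dvd i - j"
    proof -
      have "int n dvd i - j" using * by (metis dvd_mult_right int_ops(7))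
      moreover have "unit_root (2 * n) (b * i) = unit_root (2 * n) (b * j)"
        using * assms(1) by (intro unit_root_cong) (auto simp: right_diff_distrib[symmetric])
      ultimately show ?thesis using coprime_int_cong[of "int n" i j] by simp
    qed
    \<comment> \<open>The shift by n multiplies the character by exp(pi i b), which is -1 for odd b,
      and keeps coprimality to n.\<close>
    have "unit_root (2 * n) (b * int n) = unit_root 2 b"
      using unit_root_mult_cancel[of n 2 b] assms(1) by (simp add: mult.commute)
    then show "(if coprime (j + int n) (int n) then unit_root (2 * n) (b * (j + int n)) else 0) =
      unit_root 2 b * (if coprime j (int n) then unit_root (2 * n) (b * j) else 0)"
      using coprime_int_cong[of "int n" "j + int n" j] by (simp add: unit_root_add distrib_left)
  qed (use assms True in \<open>auto simp: unit_root_eq_1_iff\<close>)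
  then show ?thesis using True by (simp add: circ_eigenvalue_def)
next
  case False
  define c where "c = nat b div 2"
  have b: "b = 2 * int c" using False assms(2) by (simp add: c_def zdiv_int)
  have eq: "unit_root (2 * n) (b * j) = unit_root n (int c * j)" for j
    using unit_root_mult_cancel[of 2 n "int c * j"] by (simp add: b mult.assoc)
  have "(\<Sum>j\<in>{0..<int (2 * n)}. if coprime j (int n) then unit_root (2 * n) (b * j) else 0)
    = 2 * (\<Sum>j\<in>{0..<int n}. if coprime j (int n) then unit_root n (int c * j) else 0)"
    unfolding eq
  proof (rule sum_double_period)
    fix i j assume *: "int n dvd i - j"
    then have "unit_root n (int c * i) = unit_root n (int c * j)"
      using assms(1) by (intro unit_root_cong) (auto simp: right_diff_distrib[symmetric])
    then show "(if coprime i (int n) then unit_root n (int c * i) else 0) =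
      (if coprime j (int n) then unit_root n (int c * j) else 0)"
      using coprime_int_cong[OF *] by simp
  qed
  then show ?thesis
    using False by (simp add: ramanujan_sum[OF assms(1) refl] circ_eigenvalue_def Let_def c_def)
qed

text \<open>Translating j by i turns i - j into -j, whose sign is irrelevant to coprimality, and
  splits the value at i off the character.\<close>

lemma circulant_eigenvector:
  assumes "n > 0" "b \<ge> 0"
  shows "(\<Sum>j\<in>{0..<int (2 * n)}. if coprime (i - j) (int n) then unit_root (2 * n) (b * j) else 0)
    = of_real (circ_eigenvalue n b) * unit_root (2 * n) (b * i)" (is "(\<Sum>j\<in>_. ?g j) = _")
proof -
  have "(\<Sum>j\<in>{0..<int (2 * n)}. ?g j) = (\<Sum>j\<in>{0..<int (2 * n)}. ?g (j + i))"
  proof (rule sum_periodic_shift[symmetric])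
    fix k l assume *: "int (2 * n) dvd k - l"
    then have "int n dvd (i - k) - (i - l)"
      by (metis diff_diff_eq2 diff_add_cancel add_diff_cancel_left' dvd_diff_commute dvd_mult_right int_ops(7) add_diff_eq)
    moreover have "unit_root (2 * n) (b * k) = unit_root (2 * n) (b * l)"
      using * assms(1) by (intro unit_root_cong) (auto simp: right_diff_distrib[symmetric])
    ultimately show "?g k = ?g l" using coprime_int_cong[of "int n" "i - k" "i - l"] by simp
  qed (use assms in simp)
  also have "\<dots> = (\<Sum>j\<in>{0..<int (2 * n)}. (if coprime j (int n) then unit_root (2 * n) (b * j) else 0)
      * unit_root (2 * n) (b * i))"
    by (rule sum.cong) (auto simp: unit_root_add distrib_left)
  finally show ?thesis
    by (simp only: sum_distrib_right[symmetric] sum_coprime_unit_root_double[OF assms])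
qed

lemma sum_unit_root:
  assumes "a \<in> {0..<int N}"
  shows "(\<Sum>j\<in>{0..<int N}. unit_root N (a * j)) = (if a = 0 then of_nat N else 0)"
  using assms sum_unit_root_eq_0[of N a] zdvd_not_zless[of a "int N"] by (cases "a = 0") auto

lemma unit_root_orthogonal:
  assumes "a \<in> {0..<int N}" "b \<in> {0..<int N}"
  shows "(\<Sum>j\<in>{0..<int N}. unit_root N (a * j) * cnj (unit_root N (b * j))) = (if a = b then of_nat N else 0)"
proof -
  have "(\<Sum>j\<in>{0..<int N}. unit_root N (a * j) * cnj (unit_root N (b * j)))
    = (\<Sum>j\<in>{0..<int N}. unit_root N ((a - b) * j))"
    by (simp add: cnj_unit_root unit_root_add[symmetric] left_diff_distrib)
  moreover have "\<not> int N dvd a - b" if "a \<noteq> b"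
  proof
    assume "int N dvd a - b"
    then have "a mod int N = b mod int N" by (simp add: mod_eq_dvd_iff)
    then show False using that assms by simp
  qed
  ultimately show ?thesis using assms sum_unit_root_eq_0[of N "a - b"] by auto
qed

section \<open>The block matrix and its eigenvectors\<close>

text \<open>
  \<open>Inr j\<close> stands for the vertex \<open>x\<^sup>j y\<close>, and \<open>Inl i\<close> for the \<open>i\<close>-th of the \<open>2 \<phi>(n)\<close> vertices that are powers
  of \<open>x\<close>, in an arbitrary enumeration. The same index set labels the eigenvectors: \<open>Inl a\<close> and \<open>Inr b\<close>
  with nonzero \<open>a\<close> and \<open>b\<close> are characters supported on one block, \<open>Inl 0\<close> and \<open>Inr 0\<close> are the two
  vectors that are constant on both blocks.
\<close>

fun dic_dist :: "nat \<Rightarrow> int + int \<Rightarrow> int + int \<Rightarrow> real" where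
  "dic_dist n (Inl i) (Inl j) = (if i = j then 0 else 2)"
| "dic_dist n (Inl i) (Inr j) = 1"
| "dic_dist n (Inr i) (Inl j) = 1"
| "dic_dist n (Inr i) (Inr j) = (if i = j then 0 else if coprime (i - j) (int n) then 1 else 2)"

definition dic_index :: "nat \<Rightarrow> (int + int) set" where
  "dic_index n = {0..<int (2 * totient n)} <+> {0..<int (2 * n)}"

lemma sum_dic_index:
  "(\<Sum>v\<in>dic_index n. F v) =
    (\<Sum>i\<in>{0..<int (2 * totient n)}. F (Inl i)) + (\<Sum>j\<in>{0..<int (2 * n)}. F (Inr j))"
  unfolding dic_index_def by (simp add: sum.Plus)

lemma dic_dist_row_Inl:
  fixes F :: "int + int \<Rightarrow> complex"
  assumes "i \<in> {0..<int (2 * totient n)}"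
  shows "(\<Sum>w\<in>dic_index n. of_real (dic_dist n (Inl i) w) * F w) =
    2 * (\<Sum>j\<in>{0..<int (2 * totient n)}. F (Inl j)) - 2 * F (Inl i) + (\<Sum>j\<in>{0..<int (2 * n)}. F (Inr j))"
proof -
  have "(\<Sum>j\<in>{0..<int (2 * totient n)}. of_real (dic_dist n (Inl i) (Inl j)) * F (Inl j))
    = (\<Sum>j\<in>{0..<int (2 * totient n)}. 2 * F (Inl j) - (if i = j then 2 * F (Inl j) else 0))"
    by (rule sum.cong) auto
  then show ?thesis
    using assms by (simp add: sum_dic_index sum_subtractf sum_distrib_left sum.delta)
qed

lemma dic_dist_row_Inr:
  fixes F :: "int + int \<Rightarrow> complex"
  assumes "n \<ge> 2" "i \<in> {0..<int (2 * n)}"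
  shows "(\<Sum>w\<in>dic_index n. of_real (dic_dist n (Inr i) w) * F w) =
    (\<Sum>j\<in>{0..<int (2 * totient n)}. F (Inl j)) + 2 * (\<Sum>j\<in>{0..<int (2 * n)}. F (Inr j))
      - 2 * F (Inr i) - (\<Sum>j\<in>{0..<int (2 * n)}. if coprime (i - j) (int n) then F (Inr j) else 0)"
proof -
  have "\<not> coprime 0 (int n)" using assms(1) by simp
  \<comment> \<open>As 0 is not coprime to n >= 2, the circulant has zero diagonal, and the entry
    for i = j is 2 - 2 - 0.\<close>
  then have "(\<Sum>j\<in>{0..<int (2 * n)}. of_real (dic_dist n (Inr i) (Inr j)) * F (Inr j))
    = (\<Sum>j\<in>{0..<int (2 * n)}. 2 * F (Inr j) - (if i = j then 2 * F (Inr j) else 0)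
        - (if coprime (i - j) (int n) then F (Inr j) else 0))"
    by (intro sum.cong) auto
  then show ?thesis
    using assms(2) by (simp add: sum_dic_index sum_subtractf sum_distrib_left sum.delta)
qed

text \<open>Half the difference of the eigenvalues of the quotient matrix with rows (4 phi(n) - 2, 2
  n) and (2 phi(n), 4 n - 2 - 2 phi(n)): the diagonal entries differ by twice 3 phi(n) - 2 n, and
  the off-diagonal ones have product 4 n phi(n).\<close>

definition dic_disc :: "nat \<Rightarrow> real" where
  "dic_disc n = sqrt ((3 * real (totient n) - 2 * real n)\<^sup>2 + 4 * real n * real (totient n))"

text \<open>
  A block-constant vector with entries \<open>2 n\<close> and \<open>\<beta>\<close> is an eigenvector for \<open>\<lambda>\<close> only if
  \<open>\<beta> = \<lambda> - 2 (2 \<phi>(n) - 1)\<close>, by the rows of the first block.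
\<close>

fun dic_coeff_X :: "nat \<Rightarrow> int + int \<Rightarrow> real" where
  "dic_coeff_X n (Inl a) = (if a = 0 then 2 * real n else 1)"
| "dic_coeff_X n (Inr b) = (if b = 0 then 2 * real n else 0)"

text \<open>With \<lambda> = phi(n) + 2 (n - 1) +- \<open>dic_disc n\<close>, the entry \<beta>
  becomes 2 n - 3 phi(n) +- \<open>dic_disc n\<close>.\<close>

fun dic_coeff_Y :: "nat \<Rightarrow> int + int \<Rightarrow> real" where
  "dic_coeff_Y n (Inl a) = (if a = 0 then 2 * real n - 3 * real (totient n) + dic_disc n else 0)"
| "dic_coeff_Y n (Inr b) = (if b = 0 then 2 * real n - 3 * real (totient n) - dic_disc n else 1)"

text \<open>A label selects its character on its own block and the trivial one on the other. The
  labels \<open>Inl 0\<close> and \<open>Inr 0\<close> are trivial on both, so one formula covers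
  the block-constant vectors as well.\<close>

fun dic_eigenvector :: "nat \<Rightarrow> int + int \<Rightarrow> int + int \<Rightarrow> complex" where
  "dic_eigenvector n x (Inl i) = of_real (dic_coeff_X n x) * unit_root (2 * totient n) (case_sum id (\<lambda>_. 0) x * i)"
| "dic_eigenvector n x (Inr j) = of_real (dic_coeff_Y n x) * unit_root (2 * n) (case_sum (\<lambda>_. 0) id x * j)"

fun dic_eigenvalue :: "nat \<Rightarrow> int + int \<Rightarrow> real" where
  "dic_eigenvalue n (Inl a) = (if a = 0 then real (totient n) + 2 * (real n - 1) + dic_disc n else -2)"
| "dic_eigenvalue n (Inr b) = (if b = 0 then real (totient n) + 2 * (real n - 1) - dic_disc n
    else -2 - circ_eigenvalue n b)"

lemma dic_disc_square:
  "dic_disc n * dic_disc n = (3 * real (totient n) - 2 * real n)\<^sup>2 + 4 * real n * real (totient n)"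
  by (simp add: dic_disc_def)

lemma circ_eigenvalue_0: "n > 0 \<Longrightarrow> circ_eigenvalue n 0 = 2 * real (totient n)"
  by (simp add: circ_eigenvalue_def moebius_mu_def Let_def)

lemma dic_eigenvector_inner:
  assumes "n \<ge> 2" "x \<in> dic_index n" "y \<in> dic_index n"
  shows "(\<Sum>v\<in>dic_index n. dic_eigenvector n x v * cnj (dic_eigenvector n y v)) =
    of_real (dic_coeff_X n x * dic_coeff_X n y *
        (if case_sum id (\<lambda>_. 0) x = case_sum id (\<lambda>_. 0) y then 2 * real (totient n) else 0)
      + dic_coeff_Y n x * dic_coeff_Y n y *
        (if case_sum (\<lambda>_. 0) id x = case_sum (\<lambda>_. 0) id y then 2 * real n else 0))"
proof -
  have l: "case_sum id (\<lambda>_. 0) x \<in> {0..<int (2 * totient n)}" if "x \<in> dic_index n" for x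
    using that assms(1) by (auto simp: dic_index_def)
  have r: "case_sum (\<lambda>_. 0) id x \<in> {0..<int (2 * n)}" if "x \<in> dic_index n" for x
    using that assms(1) by (auto simp: dic_index_def)
  have *: "complex_of_real c * u * cnj (of_real d * w) = of_real (c * d) * (u * cnj w)" for c d u w
    by simp
  show ?thesis
    unfolding sum_dic_index dic_eigenvector.simps * sum_distrib_left[symmetric]
      unit_root_orthogonal[OF l[OF assms(2)] l[OF assms(3)]]
      unit_root_orthogonal[OF r[OF assms(2)] r[OF assms(3)]]
    by simp
qed

text \<open>All pairs but \<open>Inl 0\<close> with \<open>Inr 0\<close> have, on each block,
  distinct characters or a zero coefficient. For the exceptional pair the second entries multiply to
  -4 n phi(n); weighted with the block size 2 n, this cancels (2 n)^2 times the block size 2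
  phi(n).\<close>

lemma dic_eigenvector_orthogonal:
  assumes "n \<ge> 2" "x \<in> dic_index n" "y \<in> dic_index n" "x \<noteq> y"
  shows "(\<Sum>v\<in>dic_index n. dic_eigenvector n x v * cnj (dic_eigenvector n y v)) = 0"
proof -
  have "(2 * real n - 3 * real (totient n) + dic_disc n) * (2 * real n - 3 * real (totient n) - dic_disc n)
    = - 4 * real n * real (totient n)"
    using dic_disc_square[of n] by (simp add: algebra_simps power2_eq_square)
  then have "2 * real n * (2 * real n) * (2 * real (totient n)) +
    (2 * real n - 3 * real (totient n) + dic_disc n) * (2 * real n - 3 * real (totient n) - dic_disc n)
      * (2 * real n) = 0"
    by simp
  then show ?thesis
    unfolding dic_eigenvector_inner[OF assms(1-3)] of_real_eq_0_iff using assms(4)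
    by (cases x; cases y) (auto simp: algebra_simps)
qed

lemma dic_eigenvector_norm:
  assumes "n \<ge> 2" "x \<in> dic_index n"
  shows "(\<Sum>v\<in>dic_index n. dic_eigenvector n x v * cnj (dic_eigenvector n x v)) \<noteq> 0"
proof -
  have "dic_coeff_X n x * dic_coeff_X n x * (2 * real (totient n))
      + dic_coeff_Y n x * dic_coeff_Y n x * (2 * real n) > 0"
  proof (cases "dic_coeff_X n x = 0")
    case True
    \<comment> \<open>The first coefficient vanishes only for \<open>Inr b\<close> with b nonzero,
      where the second one is 1.\<close>
    then have "dic_coeff_Y n x \<noteq> 0" using assms(1) by (cases x) (auto split: if_splits)
    then have "dic_coeff_Y n x * dic_coeff_Y n x > 0"
      by (metis not_real_square_gt_zero)
    then show ?thesis using True assms(1) by simp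
  next
    case False
    then have "dic_coeff_X n x * dic_coeff_X n x > 0"
      by (metis not_real_square_gt_zero)
    then show ?thesis using assms(1) by (intro add_pos_nonneg) auto
  qed
  then show ?thesis
    unfolding dic_eigenvector_inner[OF assms assms(2)] by (simp only: refl if_True of_real_eq_0_iff)
qed

lemma dic_eigenvector:
  assumes "n \<ge> 2" "x \<in> dic_index n" "v \<in> dic_index n"
  shows "(\<Sum>w\<in>dic_index n. of_real (dic_dist n v w) * dic_eigenvector n x w) =
    of_real (dic_eigenvalue n x) * dic_eigenvector n x v"
proof -
  define p where "p = case_sum id (\<lambda>_. 0) x"
  define q where "q = case_sum (\<lambda>_. 0) id x"
  have p: "p \<in> {0..<int (2 * totient n)}" and q: "q \<in> {0..<int (2 * n)}"
    using assms by (auto simp: dic_index_def p_def q_def)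
  have sum_l: "(\<Sum>j\<in>{0..<int (2 * totient n)}. dic_eigenvector n x (Inl j))
      = of_real (dic_coeff_X n x * (if p = 0 then 2 * real (totient n) else 0))"
    unfolding dic_eigenvector.simps p_def[symmetric] sum_distrib_left[symmetric] sum_unit_root[OF p] by simp
  have sum_r: "(\<Sum>j\<in>{0..<int (2 * n)}. dic_eigenvector n x (Inr j))
      = of_real (dic_coeff_Y n x * (if q = 0 then 2 * real n else 0))"
    unfolding dic_eigenvector.simps q_def[symmetric] sum_distrib_left[symmetric] sum_unit_root[OF q] by simp
  \<comment> \<open>For the block-constant vectors the rows of the first block hold by the choice of
    \<beta>; those of the second block amount to the quadratic equation for \<lambda>.\<close>
  have disc: "complex_of_real (dic_disc n) * of_real (dic_disc n)
      = (3 * of_nat (totient n) - 2 * of_nat n)\<^sup>2 + 4 * of_nat n * of_nat (totient n)"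
    unfolding of_real_mult[symmetric] dic_disc_square by simp
  show ?thesis
  proof (cases v)
    case (Inl i)
    then have i: "i \<in> {0..<int (2 * totient n)}" using assms(3) by (auto simp: dic_index_def)
    show ?thesis
      unfolding Inl dic_dist_row_Inl[OF i] sum_l sum_r
      by (cases x) (auto simp: p_def q_def algebra_simps)
  next
    case (Inr i)
    then have i: "i \<in> {0..<int (2 * n)}" using assms(3) by (auto simp: dic_index_def)
    have "(\<Sum>j\<in>{0..<int (2 * n)}. if coprime (i - j) (int n) then dic_eigenvector n x (Inr j) else 0)
      = of_real (dic_coeff_Y n x) * (\<Sum>j\<in>{0..<int (2 * n)}.
          if coprime (i - j) (int n) then unit_root (2 * n) (q * j) else 0)"
      unfolding sum_distrib_left by (rule sum.cong) (auto simp: q_def)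
    also have "\<dots> = of_real (dic_coeff_Y n x) * (of_real (circ_eigenvalue n q) * unit_root (2 * n) (q * i))"
      using circulant_eigenvector[of n q i] assms(1) q by simp
    finally have conv: "(\<Sum>j\<in>{0..<int (2 * n)}. if coprime (i - j) (int n) then dic_eigenvector n x (Inr j) else 0)
      = of_real (circ_eigenvalue n q * dic_coeff_Y n x) * unit_root (2 * n) (q * i)"
      by simp
    have "circ_eigenvalue n 0 = 2 * real (totient n)" using circ_eigenvalue_0 assms(1) by simp
    then show ?thesis
      unfolding Inr dic_dist_row_Inr[OF assms(1) i] sum_l sum_r conv
      using disc
      by (cases x) (auto simp: p_def q_def algebra_simps power2_eq_square)
  qed
qed

lemma finite_dic_index: "finite (dic_index n)"
  by (simp add: dic_index_def)

lemma proots_char_poly_dic_dist: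
  assumes "n \<ge> 2" "distinct vs" "set vs = dic_index n"
  shows "proots (char_poly (mat (length vs) (length vs) (\<lambda>(i, j). dic_dist n (vs ! i) (vs ! j))))
    = image_mset (dic_eigenvalue n) (mset_set (dic_index n))"
proof (rule proots_char_poly_orthogonal_eigenvectors[where f = "dic_eigenvector n"])
  show "card (dic_index n) = length vs" using assms by (metis distinct_card)
qed (use assms in \<open>simp_all only: finite_dic_index dic_eigenvector dic_eigenvector_orthogonal
  dic_eigenvector_norm not_False_eq_True\<close>)

section \<open>The multiset of eigenvalues\<close>

text \<open>Elements are grouped by h and not by G o h, because different t may give the same
  eigenvalue; the multiset sum merges them.\<close>

lemma image_mset_mset_set_fibres:
  assumes "finite S" "finite T" "h ` S \<subseteq> T"
  shows "image_mset (\<lambda>c. G (h c)) (mset_set S) = (\<Sum>t\<in>T. replicate_mset (card {c\<in>S. h c = t}) (G t))"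
  using assms(1,3)
proof (induction S rule: finite_induct)
  case (insert x S)
  have "card {c \<in> insert x S. h c = t} = card {c\<in>S. h c = t} + (if t = h x then 1 else 0)" for t
  proof -
    have "{c \<in> insert x S. h c = t} = (if t = h x then insert x {c\<in>S. h c = t} else {c\<in>S. h c = t})"
      by auto
    then show ?thesis using insert.hyps by simp
  qed
  then have "replicate_mset (card {c \<in> insert x S. h c = t}) (G t)
      = replicate_mset (card {c\<in>S. h c = t}) (G t) + (if t = h x then {#G t#} else {#})" for t
    by simp
  then show ?case using insert assms(2) by (simp add: sum.distrib sum.delta)
qed simp

lemma replicate_mset_plus: "replicate_mset (a + b) x = replicate_mset a x + replicate_mset b x"
  by (induction a) auto

lemma sum_replicate_mset: "(\<Sum>t\<in>T. replicate_mset (k t) x) = replicate_mset (\<Sum>t\<in>T. k t) x"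
  by (induction T rule: infinite_finite_induct) (auto simp: replicate_mset_plus)

lemma image_mset_const_mset_set: "image_mset (\<lambda>_. x) (mset_set S) = replicate_mset (card S) x"
  by (simp add: image_mset_const_eq)

text \<open>A squarefree number is the product of its primes. Hence mu vanishes at the divisors of n
  that do not divide the radical.\<close>

lemma squarefree_dvd_radical:
  fixes t n :: nat
  assumes "squarefree t" "t dvd n" "n > 0"
  shows "t dvd \<Prod>(prime_factors n)"
proof -
  have t: "t \<noteq> 0" using assms by auto
  have "t = (\<Prod>p\<in>prime_factors t. p ^ multiplicity p t)"
    using prime_factorization_nat[of t] t by simp
  also have "\<dots> = \<Prod>(prime_factors t)"
    using assms(1) t squarefree_factorial_semiring'[of t] by simp
  finally have "t = \<Prod>(prime_factors t)" .
  moreover have "\<Prod>(prime_factors t) dvd \<Prod>(prime_factors n)"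
    using assms by (intro prod_dvd_prod_subset dvd_prime_factors) auto
  ultimately show ?thesis by simp
qed

lemma radical_dvd:
  fixes n :: nat
  assumes "n > 0"
  shows "\<Prod>(prime_factors n) dvd n"
proof -
  have "\<Prod>(prime_factors n) dvd (\<Prod>p\<in>prime_factors n. p ^ multiplicity p n)"
    by (rule prod_dvd_prod) (auto simp: prime_factors_multiplicity)
  then show ?thesis using prime_factorization_nat[of n] assms by simp
qed

lemma card_div_gcd_eq_totient:
  assumes "n > 0" "t dvd n" "t \<noteq> 1"
  shows "card {c\<in>{1..<n}. n div gcd n c = t} = totient t"
proof -
  have eq: "n div g = t \<longleftrightarrow> g = n div t" if "g dvd n" for g
    using that assms by (auto elim!: dvdE)
  have "t > 1" using assms by (cases "t = 0") auto
  then have "n div t < n" using assms(1) by (intro div_less_dividend)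
  \<comment> \<open>The endpoint c = n would give t = 1, which is excluded, so it can be added to
    match the range of \<open>card_gcd_eq_totient\<close>.\<close>
  then have "{c\<in>{1..<n}. n div gcd n c = t} = {k\<in>{0<..n}. gcd k n = n div t}"
    using eq[of "gcd n _"] by (auto simp: gcd.commute[of _ n] order_le_less)
  moreover have "n div t dvd n" using assms(2) by (metis dvd_div_mult_self dvd_triv_left)
  moreover have "n div (n div t) = t" using eq[of "n div t"] calculation(2) by simp
  ultimately show ?thesis using card_gcd_eq_totient[of n "n div t"] assms(1) by simp
qed

definition ramanujan_eigenvalue :: "nat \<Rightarrow> nat \<Rightarrow> real" where
  "ramanujan_eigenvalue n t = -2 - 2 * of_int (moebius_mu t) * (real (totient n) / real (totient t))"

text \<open>The value -2 comes n times from odd b, and n - n0 times from even b whose t is not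
  squarefree.\<close>

lemma circulant_spectrum:
  assumes "n \<ge> 2" and n0: "n0 = \<Prod>(prime_factors n)"
  shows "image_mset (\<lambda>b. -2 - circ_eigenvalue n b) (mset_set {1..<int (2 * n)}) =
    replicate_mset (2 * n - n0) (-2)
      + (\<Sum>t\<in>{t. t dvd n0} - {1}. replicate_mset (totient t) (ramanujan_eigenvalue n t))"
proof -
  let ?G = "ramanujan_eigenvalue n"
  have n0_dvd: "n0 dvd n" using radical_dvd assms by simp
  then have n0_pos: "n0 > 0" using assms(1) by (auto intro: gr0I)
  have two_n: "2 * n - n0 = n + (n - n0)"
    using dvd_imp_le[OF n0_dvd] assms(1) by simp
  have fin: "finite {t. t dvd n}" using assms(1) by simp
  let ?odd = "(\<lambda>k. 2 * int k + 1) ` {0..<n}" and ?even = "(\<lambda>c. 2 * int c) ` {1..<n}"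
  have "{1..<int (2 * n)} = ?odd \<union> ?even"
  proof (intro equalityI subsetI)
    fix b assume b: "b \<in> {1..<int (2 * n)}"
    show "b \<in> ?odd \<union> ?even"
    proof (cases "even b")
      case True
      then obtain c where "b = 2 * c" by (elim evenE)
      then have "b = 2 * int (nat c)" "nat c \<in> {1..<n}" using b by auto
      then show ?thesis by blast
    next
      case False
      then obtain c where "b = 2 * c + 1" by (elim oddE)
      then have "b = 2 * int (nat c) + 1" "nat c \<in> {0..<n}" using b by auto
      then show ?thesis by blast
    qed
  qed auto
  moreover have "?odd \<inter> ?even = {}" by (auto, presburger)
  ultimately have "mset_set {1..<int (2 * n)} = mset_set ?odd + mset_set ?even"
    by (simp add: mset_set_Union)
  also have "mset_set ?odd = image_mset (\<lambda>k. 2 * int k + 1) (mset_set {0..<n})"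
    by (rule image_mset_mset_set[symmetric]) (auto intro: inj_onI)
  also have "mset_set ?even = image_mset (\<lambda>c. 2 * int c) (mset_set {1..<n})"
    by (rule image_mset_mset_set[symmetric]) (auto intro: inj_onI)
  finally have "image_mset (\<lambda>b. -2 - circ_eigenvalue n b) (mset_set {1..<int (2 * n)}) =
      image_mset (\<lambda>_. -2) (mset_set {0..<n}) + image_mset (\<lambda>c. ?G (n div gcd n c)) (mset_set {1..<n})"
    by (simp add: image_mset.compositionality o_def circ_eigenvalue_def ramanujan_eigenvalue_def Let_def
        nat_mult_distrib)
  also have "image_mset (\<lambda>c. ?G (n div gcd n c)) (mset_set {1..<n}) =
      (\<Sum>t\<in>{t. t dvd n} - {1}. replicate_mset (card {c\<in>{1..<n}. n div gcd n c = t}) (?G t))"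
  proof (rule image_mset_mset_set_fibres)
    show "(\<lambda>c. n div gcd n c) ` {1..<n} \<subseteq> {t. t dvd n} - {1}"
    proof clarify
      fix c assume c: "c \<in> {1..<n}"
      have "n div gcd n c dvd n" by (metis dvd_div_mult_self dvd_triv_left gcd_dvd1)
      moreover have "n div gcd n c \<noteq> 1"
      proof
        assume "n div gcd n c = 1"
        then have "gcd n c = n" by (metis dvd_div_mult_self gcd_dvd1 mult_1)
        then have "n dvd c" by (metis gcd_dvd2)
        then show False using c by (auto dest: dvd_imp_le)
      qed
      ultimately show "n div gcd n c \<in> {t. t dvd n} - {1}" by simp
    qed
  qed (use fin in auto)
  also have "\<dots> = (\<Sum>t\<in>{t. t dvd n} - {1}. replicate_mset (totient t) (?G t))"
    using assms(1) by (intro sum.cong refl) (subst card_div_gcd_eq_totient, auto)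
  also have "{t. t dvd n} - {1} = ({t. t dvd n0} - {1}) \<union> ({t. t dvd n} - {t. t dvd n0})"
    using n0_dvd dvd_trans by auto
  also have "(\<Sum>t\<in>\<dots>. replicate_mset (totient t) (?G t)) =
      (\<Sum>t\<in>{t. t dvd n0} - {1}. replicate_mset (totient t) (?G t))
      + (\<Sum>t\<in>{t. t dvd n} - {t. t dvd n0}. replicate_mset (totient t) (?G t))"
    using fin n0_pos by (intro sum.union_disjoint) auto
  also have "(\<Sum>t\<in>{t. t dvd n} - {t. t dvd n0}. replicate_mset (totient t) (?G t))
      = (\<Sum>t\<in>{t. t dvd n} - {t. t dvd n0}. replicate_mset (totient t) (-2))"
  proof (rule sum.cong[OF refl])
    fix t assume "t \<in> {t. t dvd n} - {t. t dvd n0}"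
    then have "\<not> squarefree t" using squarefree_dvd_radical[of t n] assms by auto
    then show "replicate_mset (totient t) (?G t) = replicate_mset (totient t) (-2)"
      by (simp add: ramanujan_eigenvalue_def moebius_mu_def)
  qed
  also have "\<dots> = replicate_mset (n - n0) (-2)"
  proof -
    have "(\<Sum>t\<in>{t. t dvd n} - {t. t dvd n0}. totient t) = n - n0"
      using fin n0_pos dvd_trans[OF _ n0_dvd] by (subst sum_diff_nat) (auto simp: totient_divisor_sum)
    then show ?thesis by (simp add: sum_replicate_mset)
  qed
  finally show ?thesis
    by (simp only: image_mset_const_mset_set card_atLeastLessThan diff_zero replicate_mset_plus two_n add_ac)
qed

lemma dic_spectrum:
  assumes "n \<ge> 2" and n0: "n0 = \<Prod>(prime_factors n)"
  shows "image_mset (dic_eigenvalue n) (mset_set (dic_index n)) =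
    replicate_mset (2 * (totient n + n) - n0 - 1) (-2)
     + (\<Sum>t\<in>{t. t dvd n0} - {1}. replicate_mset (totient t) (ramanujan_eigenvalue n t))
     + {# real (totient n) + 2 * (real n - 1) + dic_disc n, real (totient n) + 2 * (real n - 1) - dic_disc n #}"
proof -
  have n0_le: "n0 \<le> n" using radical_dvd[of n] assms by (auto intro: dvd_imp_le)
  have tot: "totient n > 0" using assms(1) by simp
  have "mset_set (dic_index n) = mset_set (Inl ` {0..<int (2 * totient n)}) + mset_set (Inr ` {0..<int (2 * n)})"
    unfolding dic_index_def Plus_def by (rule mset_set_Union) auto
  also have "\<dots> = image_mset Inl (mset_set {0..<int (2 * totient n)}) + image_mset Inr (mset_set {0..<int (2 * n)})"
    by (simp add: image_mset_mset_set)
  also have "{0..<int (2 * totient n)} = insert 0 {1..<int (2 * totient n)}" using tot by auto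
  also have "{0..<int (2 * n)} = insert 0 {1..<int (2 * n)}" using assms(1) by auto
  finally have "image_mset (dic_eigenvalue n) (mset_set (dic_index n)) =
      {# dic_eigenvalue n (Inl 0), dic_eigenvalue n (Inr 0) #}
      + (image_mset (\<lambda>a. dic_eigenvalue n (Inl a)) (mset_set {1..<int (2 * totient n)})
      + image_mset (\<lambda>b. dic_eigenvalue n (Inr b)) (mset_set {1..<int (2 * n)}))"
    by (simp add: image_mset.compositionality o_def)
  also have "image_mset (\<lambda>a. dic_eigenvalue n (Inl a)) (mset_set {1..<int (2 * totient n)})
      = image_mset (\<lambda>_. -2) (mset_set {1..<int (2 * totient n)})"
    by (rule image_mset_cong) auto
  also have "\<dots> = replicate_mset (2 * totient n - 1) (-2)"
  proof -
    have "card {1..<int (2 * totient n)} = 2 * totient n - 1" unfolding card_atLeastLessThan_int by linarith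
    then show ?thesis by (simp only: image_mset_const_mset_set)
  qed
  also have "image_mset (\<lambda>b. dic_eigenvalue n (Inr b)) (mset_set {1..<int (2 * n)})
      = image_mset (\<lambda>b. -2 - circ_eigenvalue n b) (mset_set {1..<int (2 * n)})"
    by (rule image_mset_cong) auto
  also note circulant_spectrum[OF assms]
  also have "replicate_mset (2 * totient n - 1) (-2) + (replicate_mset (2 * n - n0) (-2)
      + (\<Sum>t\<in>{t. t dvd n0} - {1}. replicate_mset (totient t) (ramanujan_eigenvalue n t)))
    = replicate_mset (2 * (totient n + n) - n0 - 1) (-2)
      + (\<Sum>t\<in>{t. t dvd n0} - {1}. replicate_mset (totient t) (ramanujan_eigenvalue n t))"
  proof -
    \<comment> \<open>The subtractions are on natural numbers; \<open>n0_le\<close> and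
      \<open>tot\<close> keep them from truncating.\<close>
    have "2 * (totient n + n) - n0 - 1 = (2 * totient n - 1) + (2 * n - n0)"
      using n0_le tot by (auto simp: le_iff_add gr0_conv_Suc)
    then show ?thesis by (simp only: replicate_mset_plus add.assoc)
  qed
  finally show ?thesis by simp
qed

text \<open>Divisors of m > 0 are at least 1, so a strictly increasing enumeration has the divisor 1
  at index 1, and leaving out that index leaves out that divisor.\<close>

lemma sum_divisor_enumeration:
  fixes d :: "nat \<Rightarrow> nat" and F :: "nat \<Rightarrow> 'a :: comm_monoid_add"
  assumes "m > 0" "strict_mono_on {1..N} d" "d ` {1..N} = {e. e dvd m}"
  shows "(\<Sum>i\<in>{2..N}. F (d i)) = (\<Sum>t\<in>{t. t dvd m} - {1}. F t)"
proof -
  have inj: "inj_on d {1..N}" using assms(2) by (rule strict_mono_on_imp_inj_on)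
  have "1 \<in> d ` {1..N}" using assms(3) by simp
  then obtain i where i: "i \<in> {1..N}" "d i = 1" by auto
  then have 1: "1 \<in> {1..N}" by auto
  then have "d 1 dvd m" using assms(3) by blast
  then have "d 1 > 0" using assms(1) by (auto intro: gr0I)
  have "d 1 = 1"
  proof (cases "i = 1")
    case False
    then have "d 1 < d i" using i 1 by (intro strict_mono_onD[OF assms(2)]) auto
    then show ?thesis using i \<open>d 1 > 0\<close> by simp
  qed (use i in simp)
  have "{2..N} = {1..N} - {1}" by auto
  then have "d ` {2..N} = {t. t dvd m} - {1}"
    using inj_on_image_set_diff[OF inj, of "{1..N}" "{1}"] 1 assms(3) \<open>d 1 = 1\<close> by simp
  moreover have "inj_on d {2..N}" using inj by (rule inj_on_subset) auto
  ultimately show ?thesis by (metis (no_types, lifting) sum.reindex_cong)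
qed

text \<open>Every enumeration of the vertices is pulled back along h to an enumeration of
  \<open>dic_index n\<close>, under which the distance matrix and the model matrix agree entry by
  entry.\<close>

lemma dic_graph_spectrum:
  assumes "n \<ge> 2"
  shows "has_distance_spectrum (remove_isolated (generating_graph (dicyclic_group n)))
    (image_mset (dic_eigenvalue n) (mset_set (dic_index n)))"
proof -
  have n_pos: "n > 0" using assms by simp
  let ?\<Gamma> = "remove_isolated (generating_graph (dicyclic_group n))"
  have "proots (char_poly (distance_matrix ?\<Gamma> vs)) = image_mset (dic_eigenvalue n) (mset_set (dic_index n))"
    if vs: "distinct vs" "set vs = verts ?\<Gamma>" for vs
  proof -
    let ?U = "{i\<in>{0..<2 * int n}. coprime i (int n)}"
    have "card {0..<int (2 * totient n)} = card ?U"
      by (simp only: card_coprime_double[OF n_pos] card_atLeastLessThan_int diff_zero nat_int)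
    moreover have "finite ?U" by (rule finite_subset[of _ "{0..<2 * int n}"]) auto
    \<comment> \<open>Any bijection will do, since distinct powers of x are all at distance
      2.\<close>
    ultimately obtain e where e: "bij_betw e {0..<int (2 * totient n)} ?U"
      using finite_same_card_bij[OF finite_atLeastLessThan_int] by blast
    define h where "h = case_sum (\<lambda>i. dicX n (e i)) (dicY n)"
    have eU: "e i \<in> ?U" if "i \<in> {0..<int (2 * totient n)}" for i
      using bij_betwE[OF e] that by blast
    have small: "2 * int n dvd i - j \<longleftrightarrow> i = j" if "i \<in> {0..<2 * int n}" "j \<in> {0..<2 * int n}" for i j
    proof
      assume "2 * int n dvd i - j"
      then have "i mod (2 * int n) = j mod (2 * int n)" by (simp add: mod_eq_dvd_iff)
      then show "i = j" using that by simp
    qed simp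
    have small_e: "2 * int n dvd e i - e j \<longleftrightarrow> i = j"
      if "i \<in> {0..<int (2 * totient n)}" "j \<in> {0..<int (2 * totient n)}" for i j
      using small[of "e i" "e j"] eU[OF that(1)] eU[OF that(2)]
        inj_on_eq_iff[OF bij_betw_imp_inj_on[OF e] that] by simp
    have dist: "real (graph_dist ?\<Gamma> (h v) (h w)) = dic_dist n v w"
      if vw: "v \<in> dic_index n" "w \<in> dic_index n" for v w
    proof -
      have X: "coprime (e i) (int n)" if "i \<in> {0..<int (2 * totient n)}" for i
        using eU[OF that] by simp
      show ?thesis
      proof (cases v; cases w)
        fix i j assume ij: "v = Inl i" "w = Inl j"
        then have "i \<in> {0..<int (2 * totient n)}" "j \<in> {0..<int (2 * totient n)}"
          using vw by (auto simp: dic_index_def)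
        then show ?thesis
          by (simp only: ij h_def sum.case dist_dic_XX[OF n_pos X X] small_e) simp
      next
        fix i j assume ij: "v = Inl i" "w = Inr j"
        then have "i \<in> {0..<int (2 * totient n)}" using vw by (auto simp: dic_index_def)
        then show ?thesis by (simp only: ij h_def sum.case dist_dic_XY[OF n_pos X]) simp
      next
        fix i j assume ij: "v = Inr i" "w = Inl j"
        then have "j \<in> {0..<int (2 * totient n)}" using vw by (auto simp: dic_index_def)
        then show ?thesis by (simp only: ij h_def sum.case dist_dic_XY[OF n_pos X]) simp
      next
        fix i j assume ij: "v = Inr i" "w = Inr j"
        then have "i \<in> {0..<2 * int n}" "j \<in> {0..<2 * int n}"
          using vw by (auto simp: dic_index_def)
        then show ?thesis
          by (simp only: ij h_def sum.case dist_dic_YY[OF n_pos] small) simp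
      qed
    qed
    have inj: "inj_on h (dic_index n)"
    proof (rule inj_onI)
      fix v w assume vw: "v \<in> dic_index n" "w \<in> dic_index n" "h v = h w"
      \<comment> \<open>Injectivity is read off distances: if h identifies v and w, their model
        distance is 0, which forces equality.\<close>
      then have "dic_dist n v w = dic_dist n v v"
        using dist[OF vw(1,2)] dist[OF vw(1,1)] by simp
      then show "v = w" by (cases v; cases w) (auto split: if_splits)
    qed
    have "h ` dic_index n = dicX n ` e ` {0..<int (2 * totient n)} \<union> dicY n ` {0..<int (2 * n)}"
      unfolding dic_index_def Plus_def image_Un by (simp add: h_def image_image)
    also have "\<dots> = verts ?\<Gamma>"
      unfolding verts_dic_graph[OF n_pos] bij_betw_imp_surj_on[OF e] by simp
    finally have img: "h ` dic_index n = verts ?\<Gamma>" .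
    define ws where "ws = map (inv_into (dic_index n) h) vs"
    have inj': "inj_on (inv_into (dic_index n) h) (verts ?\<Gamma>)"
      unfolding img[symmetric] by (rule inj_on_inv_into[OF subset_refl])
    have ws: "distinct ws" "set ws = dic_index n"
      using vs inj' inv_into_image_cancel[OF inj subset_refl]
      by (simp_all add: ws_def distinct_map img)
    have len: "length vs = length ws" by (simp add: ws_def)
    have nth: "vs ! i = h (ws ! i)" if "i < length ws" for i
    proof -
      have "vs ! i \<in> h ` dic_index n" unfolding img vs(2)[symmetric] by (rule nth_mem) (simp only: len that)
      moreover have "ws ! i = inv_into (dic_index n) h (vs ! i)" using that by (simp add: ws_def)
      ultimately show ?thesis by (simp only: f_inv_into_f)
    qed
    have "distance_matrix ?\<Gamma> vs = mat (length ws) (length ws) (\<lambda>(i, j). dic_dist n (ws ! i) (ws ! j))"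
    proof (rule eq_matI)
      fix i j
      assume "i < dim_row (mat (length ws) (length ws) (\<lambda>(i, j). dic_dist n (ws ! i) (ws ! j)))"
        "j < dim_col (mat (length ws) (length ws) (\<lambda>(i, j). dic_dist n (ws ! i) (ws ! j)))"
      then have ij: "i < length ws" "j < length ws" by simp_all
      then have "distance_matrix ?\<Gamma> vs $$ (i, j) = real (graph_dist ?\<Gamma> (vs ! i) (vs ! j))"
        by (simp add: distance_matrix_def len)
      also have "\<dots> = dic_dist n (ws ! i) (ws ! j)"
        unfolding nth[OF ij(1)] nth[OF ij(2)] using ij ws(2) nth_mem by (intro dist) blast+
      finally show "distance_matrix ?\<Gamma> vs $$ (i, j)
          = mat (length ws) (length ws) (\<lambda>(i, j). dic_dist n (ws ! i) (ws ! j)) $$ (i, j)"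
        using ij by simp
    qed (simp_all add: distance_matrix_def len)
    then show ?thesis using proots_char_poly_dic_dist[OF assms ws] by simp
  qed
  then show ?thesis
    unfolding has_distance_spectrum_def
    using graph_dic_graph[OF n_pos] connected_dic_graph[OF n_pos] by blast
qed

theorem theorem5p3:
  fixes n n0 k :: nat and d :: "nat \<Rightarrow> nat"
  assumes "n \<ge> 2"
    and "n0 = \<Prod>(prime_factors n)"
    and "k = card (prime_factors n)"
    and "strict_mono_on {1..2 ^ k} d"
    and "d ` {1..2 ^ k} = {e. e dvd n0}"
  shows "has_distance_spectrum (remove_isolated (generating_graph (dicyclic_group n)))
    (replicate_mset (2 * (totient n + n) - n0 - 1) (-2)
     + (\<Sum>i\<in>{2..2 ^ k}. replicate_mset (totient (d i))
          (-2 - 2 * real_of_int (moebius_mu (d i)) * (real (totient n) / real (totient (d i)))))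
     + {# (real (totient n) + 2 * (real n - 1))
            + sqrt ((3 * real (totient n) - 2 * real n)\<^sup>2 + 4 * real n * real (totient n)),
          (real (totient n) + 2 * (real n - 1))
            - sqrt ((3 * real (totient n) - 2 * real n)\<^sup>2 + 4 * real n * real (totient n)) #})"
proof -
  have "n0 > 0" using radical_dvd[of n] assms(1,2) by (auto intro: gr0I)
  note sums = sum_divisor_enumeration[OF this assms(4,5), where
      F = "\<lambda>t. replicate_mset (totient t) (ramanujan_eigenvalue n t)", unfolded ramanujan_eigenvalue_def]
  show ?thesis
    using dic_graph_spectrum[OF assms(1)]
    unfolding dic_spectrum[OF assms(1,2)] ramanujan_eigenvalue_def dic_disc_def sums .
qed

end
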